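(* Let $\mathcal{T}$ be the free symmetric operad over a field of characteristic $0$ generated by two ternary operations $[-,-,-]$ and $\langle -,-,-\rangle$ with no symmetry, let $\mathcal{I}\subset\mathcal{T}$ be the operadic ideal generated by the comtrans relations $$[x,y,z]+[y,x,z],\qquad \langle x,y,z\rangle+\langle y,z,x\rangle+\langle z,x,y\rangle,\qquad [x,y,z]+[z,y,x]-\langle x,y,z\rangle-\langle z,y,x\rangle,$$ so that $\mathcal{T}/\mathcal{I}$ is the comtrans operad, and let $\mathcal{I}_{\mathrm{sh}}\subset\mathcal{T}_{\mathrm{sh}}$ be the ideal in the free shuffle operad obtained by applying the forgetful functor from symmetric operads to shuffle operads. Then the following seven elements form a Gröbner basis for $\mathcal{I}_{\mathrm{sh}}$: \begin{align*} &\langle x,y,z\rangle+\langle z,y,x\rangle+[y,x,z]-[z,y,x],\\ &\langle x,z,y\rangle-\langle z,x,y\rangle+\langle z,y,x\rangle+[y,x,z]+[z,x,y],\\ &\langle y,x,z\rangle+\langle z,x,y\rangle-[y,x,z]-[z,x,y],\\ &\langle y,z,x\rangle+\langle z,x,y\rangle-\langle z,y,x\rangle-[y,x,z]+[z,y,x],\\ &[x,y,z]+[y,x,z],\\ &[x,z,y]+[z,x,y],\\ &[y,z,x]+[z,y,x], \end{align*} where the leading monomial of each element is the first term written.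
   Context: The shuffle operad $\mathcal{T}_{\mathrm{sh}}$ is the free shuffle operad generated, in arity 3, by the 12-dimensional vector space with ordered basis $$\langle x,y,z\rangle,\langle x,z,y\rangle,\langle y,x,z\rangle,\langle y,z,x\rangle,\langle z,x,y\rangle,\langle z,y,x\rangle,[x,y,z],[x,z,y],[y,x,z],[y,z,x],[z,x,y],[z,y,x],$$ where $x,y,z$ stand for the arguments $1<2<3$ and the $S_3$-action has been forgotten, so that each of these 12 symbols is regarded as a distinct ternary generating operation. The generating operations are ordered as listed, the first being the greatest; this order is extended to an admissible (degree-lexicographic) order on tree monomials of $\mathcal{T}_{\mathrm{sh}}$. A Gröbner basis of an ideal $\mathcal{J}$ of a free shuffle operad is a subset $G\subset\mathcal{J}$ such that the leading monomial of every nonzero element of $\mathcal{J}$ is divisible (in the shuffle operad sense) by the leading monomial of some element of $G$. *)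

theory Defs
  imports "HOL-Library.Poly_Mapping" "HOL-Combinatorics.Permutations"
begin

section \<open>Tree monomials\<close>

text \<open>
  Planar rooted trees whose internal vertices carry ternary operations from \<^typ>\<open>'g\<close>
  and whose leaves carry natural numbers. The same type serves for the free symmetric operad and
  for the free shuffle operad; they differ in the admitted leaf labellings.
\<close>

datatype 'g tree = Leaf nat | Node 'g "'g tree" "'g tree" "'g tree"

fun leaves :: "'g tree \<Rightarrow> nat list" where
  "leaves (Leaf i) = [i]"
| "leaves (Node g a b c) = leaves a @ leaves b @ leaves c"

abbreviation arity :: "'g tree \<Rightarrow> nat" where
  "arity t \<equiv> length (leaves t)"

definition min_leaf :: "'g tree \<Rightarrow> nat" where
  "min_leaf t = Min (set (leaves t))"

fun subst :: "(nat \<Rightarrow> 'g tree) \<Rightarrow> 'g tree \<Rightarrow> 'g tree" where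
  "subst \<tau> (Leaf i) = \<tau> i"
| "subst \<tau> (Node g a b c) = Node g (subst \<tau> a) (subst \<tau> b) (subst \<tau> c)"

definition relabel :: "(nat \<Rightarrow> nat) \<Rightarrow> 'g tree \<Rightarrow> 'g tree" where
  "relabel r t = subst (\<lambda>j. Leaf (r j)) t"

fun subtrees :: "'g tree \<Rightarrow> 'g tree set" where
  "subtrees (Leaf i) = {Leaf i}"
| "subtrees (Node g a b c) =
     insert (Node g a b c) (subtrees a \<union> subtrees b \<union> subtrees c)"

definition sym_monomials :: "nat \<Rightarrow> 'g tree set" where
  "sym_monomials n = {t. distinct (leaves t) \<and> set (leaves t) = {1..n}}"

fun is_shuffle :: "'g tree \<Rightarrow> bool" where
  "is_shuffle (Leaf i) \<longleftrightarrow> True"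
| "is_shuffle (Node g a b c) \<longleftrightarrow>
     min_leaf a < min_leaf b \<and> min_leaf b < min_leaf c \<and>
     is_shuffle a \<and> is_shuffle b \<and> is_shuffle c"

definition shuffle_monomials :: "nat \<Rightarrow> 'g tree set" where
  "shuffle_monomials n = {t \<in> sym_monomials n. is_shuffle t}"


section \<open>Linear algebra\<close>

definition scale :: "'k::field \<Rightarrow> ('a \<Rightarrow>\<^sub>0 'k) \<Rightarrow> ('a \<Rightarrow>\<^sub>0 'k)" where
  "scale c f = Poly_Mapping.map ((*) c) f"

definition linear_ext :: "('a \<Rightarrow> 'b) \<Rightarrow> ('a \<Rightarrow>\<^sub>0 'k::field) \<Rightarrow> ('b \<Rightarrow>\<^sub>0 'k)" where
  "linear_ext h f =
     (\<Sum>s\<in>Poly_Mapping.keys f. Poly_Mapping.single (h s) (Poly_Mapping.lookup f s))"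

definition bilinear_ext ::
  "('a \<Rightarrow> 'b \<Rightarrow> 'c) \<Rightarrow> ('a \<Rightarrow>\<^sub>0 'k::field) \<Rightarrow> ('b \<Rightarrow>\<^sub>0 'k) \<Rightarrow> ('c \<Rightarrow>\<^sub>0 'k)" where
  "bilinear_ext h f g =
     (\<Sum>s\<in>Poly_Mapping.keys f. \<Sum>t\<in>Poly_Mapping.keys g.
        Poly_Mapping.single (h s t) (Poly_Mapping.lookup f s * Poly_Mapping.lookup g t))"

definition is_subspace :: "('a \<Rightarrow>\<^sub>0 'k::field) set \<Rightarrow> bool" where
  "is_subspace V \<longleftrightarrow>
     0 \<in> V \<and> (\<forall>f\<in>V. \<forall>g\<in>V. f + g \<in> V) \<and> (\<forall>c. \<forall>f\<in>V. scale c f \<in> V)"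


section \<open>The free symmetric operad on ternary operations without symmetry\<close>

definition sym_operad :: "nat \<Rightarrow> ('g tree \<Rightarrow>\<^sub>0 'k::field) set" where
  "sym_operad n = {f. Poly_Mapping.keys f \<subseteq> sym_monomials n}"

text \<open>The partial composition \<open>s \<circ>\<^sub>i t\<close> with the usual block renumbering of the inputs.\<close>

definition graft :: "nat \<Rightarrow> 'g tree \<Rightarrow> 'g tree \<Rightarrow> 'g tree" where
  "graft i s t =
     subst (\<lambda>j. if j < i then Leaf j
                else if j = i then relabel (\<lambda>l. l + i - 1) t
                else Leaf (j + arity t - 1)) s"

definition sym_ideal :: "(nat \<Rightarrow> ('g tree \<Rightarrow>\<^sub>0 'k::field) set) \<Rightarrow> bool" where
  "sym_ideal J \<longleftrightarrow>
     (\<forall>n. J n \<subseteq> sym_operad n \<and> is_subspace (J n)) \<and>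
     (\<forall>n \<sigma> f. \<sigma> permutes {1..n} \<and> f \<in> J n \<longrightarrow> linear_ext (relabel \<sigma>) f \<in> J n) \<and>
     (\<forall>n m i f g. i \<in> {1..n} \<and> f \<in> sym_operad n \<and> g \<in> sym_operad m \<and> (f \<in> J n \<or> g \<in> J m)
        \<longrightarrow> bilinear_ext (graft i) f g \<in> J (n + m - 1))"

definition ideal_generated ::
  "(nat \<Rightarrow> ('g tree \<Rightarrow>\<^sub>0 'k::field) set) \<Rightarrow> nat \<Rightarrow> ('g tree \<Rightarrow>\<^sub>0 'k) set" where
  "ideal_generated R n = {f. \<forall>J. sym_ideal J \<and> (\<forall>m. R m \<subseteq> J m) \<longrightarrow> f \<in> J n}"


section \<open>The free shuffle operad and the forgetful functor\<close>

definition shuffle_operad :: "nat \<Rightarrow> ('g tree \<Rightarrow>\<^sub>0 'k::field) set" where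
  "shuffle_operad n = {f. Poly_Mapping.keys f \<subseteq> shuffle_monomials n}"

text \<open>
  A partial shuffle composition of \<open>s\<close> (arity \<open>n\<close>) and \<open>t\<close> (arity \<open>m\<close>) at input \<open>i\<close> is encoded by
  the increasing renumberings \<open>v\<close> of the inputs of \<open>s\<close> and \<open>u\<close> of the inputs of \<open>t\<close>. Since the
  images together exhaust \<open>{1..n + m - 1}\<close>, they meet only in \<open>v i = u 1\<close>.
\<close>

definition shuffle_renumbering ::
  "nat \<Rightarrow> nat \<Rightarrow> nat \<Rightarrow> (nat \<Rightarrow> nat) \<Rightarrow> (nat \<Rightarrow> nat) \<Rightarrow> bool" where
  "shuffle_renumbering n m i v u \<longleftrightarrow>
     i \<in> {1..n} \<and> strict_mono_on {1..n} v \<and> strict_mono_on {1..m} u \<and>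
     v i = u 1 \<and> v ` {1..n} \<union> u ` {1..m} = {1..n + m - 1}"

definition shuffle_graft ::
  "nat \<Rightarrow> (nat \<Rightarrow> nat) \<Rightarrow> (nat \<Rightarrow> nat) \<Rightarrow> 'g tree \<Rightarrow> 'g tree \<Rightarrow> 'g tree" where
  "shuffle_graft i v u s t = subst (\<lambda>j. if j = i then relabel u t else Leaf (v j)) s"

definition shuffle_ideal :: "(nat \<Rightarrow> ('g tree \<Rightarrow>\<^sub>0 'k::field) set) \<Rightarrow> bool" where
  "shuffle_ideal J \<longleftrightarrow>
     (\<forall>n. J n \<subseteq> shuffle_operad n \<and> is_subspace (J n)) \<and>
     (\<forall>n m i v u f g. shuffle_renumbering n m i v u \<and>
        f \<in> shuffle_operad n \<and> g \<in> shuffle_operad m \<and> (f \<in> J n \<or> g \<in> J m)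
        \<longrightarrow> bilinear_ext (shuffle_graft i v u) f g \<in> J (n + m - 1))"

text \<open>
  Forgetting the symmetric group action, each operation \<open>g\<close> without symmetry becomes six
  independent generators \<open>(g, p)\<close>, where \<open>p\<close> is the arrangement in which the inputs
  \<open>x, y, z\<close> (that is, 1, 2, 3) are fed to \<open>g\<close>.
\<close>

datatype arrangement = XYZ | XZY | YXZ | YZX | ZXY | ZYX

fun apply_arranged :: "'g \<Rightarrow> arrangement \<Rightarrow> 'g tree \<Rightarrow> 'g tree \<Rightarrow> 'g tree \<Rightarrow> 'g tree" where
  "apply_arranged g XYZ x y z = Node g x y z"
| "apply_arranged g XZY x y z = Node g x z y"
| "apply_arranged g YXZ x y z = Node g y x z"
| "apply_arranged g YZX x y z = Node g y z x"
| "apply_arranged g ZXY x y z = Node g z x y"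
| "apply_arranged g ZYX x y z = Node g z y x"

text \<open>
  On shuffle tree monomials, \<open>realize\<close> is the isomorphism from the free shuffle operad on the
  generators \<open>(g, p)\<close> to the image of the free symmetric operad under the forgetful functor;
  \<open>forget_ideal\<close> transports an ideal along it.
\<close>

fun realize :: "('g \<times> arrangement) tree \<Rightarrow> 'g tree" where
  "realize (Leaf i) = Leaf i"
| "realize (Node gp a b c) =
     apply_arranged (fst gp) (snd gp) (realize a) (realize b) (realize c)"

definition forget_ideal ::
  "(nat \<Rightarrow> ('g tree \<Rightarrow>\<^sub>0 'k::field) set) \<Rightarrow>
   nat \<Rightarrow> (('g \<times> arrangement) tree \<Rightarrow>\<^sub>0 'k) set" where
  "forget_ideal J n = {f \<in> shuffle_operad n. linear_ext realize f \<in> J n}"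


section \<open>Monomial order, divisibility and Groebner bases\<close>

fun path :: "nat \<Rightarrow> 'g tree \<Rightarrow> 'g list" where
  "path i (Leaf j) = []"
| "path i (Node g a b c) =
     g # (if i \<in> set (leaves a) then path i a
          else if i \<in> set (leaves b) then path i b
          else path i c)"

definition path_sequence :: "'g tree \<Rightarrow> 'g list list" where
  "path_sequence t = map (\<lambda>i. path i t) [1..<Suc (arity t)]"

text \<open>
  The path-degree-lexicographic order induced by a strict order \<open>r\<close> of the generators (a pair
  \<open>(g, h)\<close> in \<open>r\<close> means that \<open>g\<close> is smaller). Monomials are compared by arity; then by their path
  sequences, entry by entry, the words being compared degree-lexicographically; and then by the
  reverse lexicographic order of the leaf permutations. Note that \<^const>\<open>lenlex\<close> compares
  lengths first, and that the length of a path sequence is the arity. Path sequence and leaf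
  permutation determine a monomial, so the order is total on each arity when \<open>r\<close> is total.
\<close>

definition path_deglex :: "('g \<times> 'g) set \<Rightarrow> ('g tree \<times> 'g tree) set" where
  "path_deglex r =
     {(s, t). (path_sequence s, path_sequence t) \<in> lenlex (lenlex r) \<or>
              path_sequence s = path_sequence t \<and> (leaves t, leaves s) \<in> lex less_than}"

definition leading_monomial :: "('a \<times> 'a) set \<Rightarrow> ('a \<Rightarrow>\<^sub>0 'k::field) \<Rightarrow> 'a" where
  "leading_monomial ord f =
     (THE t. t \<in> Poly_Mapping.keys f \<and> (\<forall>s\<in>Poly_Mapping.keys f. s \<noteq> t \<longrightarrow> (s, t) \<in> ord))"

text \<open>
  A shuffle monomial \<open>s\<close> divides \<open>t\<close> if some connected part of \<open>t\<close>, with each of its leaves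
  labelled by the minimal leaf of the tree growing from it and these labels renumbered
  increasingly, is \<open>s\<close>. Here \<open>\<tau> i\<close> is the tree growing from leaf \<open>i\<close> of \<open>s\<close>.
\<close>

definition divides :: "'g tree \<Rightarrow> 'g tree \<Rightarrow> bool" where
  "divides s t \<longleftrightarrow>
     (\<exists>\<tau>. subst \<tau> s \<in> subtrees t \<and> strict_mono_on (set (leaves s)) (\<lambda>i. min_leaf (\<tau> i)))"

definition groebner_basis ::
  "('g tree \<times> 'g tree) set \<Rightarrow> (nat \<Rightarrow> ('g tree \<Rightarrow>\<^sub>0 'k::field) set) \<Rightarrow>
   ('g tree \<Rightarrow>\<^sub>0 'k) set \<Rightarrow> bool" where
  "groebner_basis ord J G \<longleftrightarrow>
     shuffle_ideal J \<and> G \<subseteq> (\<Union>n. J n) \<and>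
     (\<forall>n. \<forall>f\<in>J n. f \<noteq> 0 \<longrightarrow>
        (\<exists>g\<in>G. g \<noteq> 0 \<and> divides (leading_monomial ord g) (leading_monomial ord f)))"


section \<open>The comtrans operad\<close>

text \<open>\<open>Commutator\<close> is the operation \<open>[-,-,-]\<close> and \<open>Translator\<close> is \<open>\<langle>-,-,-\<rangle>\<close>.\<close>

datatype comtrans_op = Commutator | Translator

definition commutator :: "nat \<Rightarrow> nat \<Rightarrow> nat \<Rightarrow> (comtrans_op tree \<Rightarrow>\<^sub>0 'k::field)" where
  "commutator i j l = Poly_Mapping.single (Node Commutator (Leaf i) (Leaf j) (Leaf l)) 1"

definition translator :: "nat \<Rightarrow> nat \<Rightarrow> nat \<Rightarrow> (comtrans_op tree \<Rightarrow>\<^sub>0 'k::field)" where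
  "translator i j l = Poly_Mapping.single (Node Translator (Leaf i) (Leaf j) (Leaf l)) 1"

definition comtrans_relations :: "nat \<Rightarrow> (comtrans_op tree \<Rightarrow>\<^sub>0 'k::field) set" where
  "comtrans_relations n =
     (if n = 3 then
        {commutator 1 2 3 + commutator 2 1 3,
         translator 1 2 3 + translator 2 3 1 + translator 3 1 2,
         commutator 1 2 3 + commutator 3 2 1 - translator 1 2 3 - translator 3 2 1}
      else {})"

definition comtrans_ideal :: "nat \<Rightarrow> (comtrans_op tree \<Rightarrow>\<^sub>0 'k::field) set" where
  "comtrans_ideal = ideal_generated comtrans_relations"

type_synonym comtrans_gen = "comtrans_op \<times> arrangement"

text \<open>The generators from the greatest to the least.\<close>

definition generators :: "comtrans_gen list" where
  "generators =
     [(Translator, XYZ), (Translator, XZY), (Translator, YXZ),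
      (Translator, YZX), (Translator, ZXY), (Translator, ZYX),
      (Commutator, XYZ), (Commutator, XZY), (Commutator, YXZ),
      (Commutator, YZX), (Commutator, ZXY), (Commutator, ZYX)]"

definition generator_less :: "(comtrans_gen \<times> comtrans_gen) set" where
  "generator_less = {(generators ! i, generators ! j) | i j. j < i \<and> i < length generators}"

definition comtrans_less :: "(comtrans_gen tree \<times> comtrans_gen tree) set" where
  "comtrans_less = path_deglex generator_less"

definition corolla :: "comtrans_gen \<Rightarrow> comtrans_gen tree" where
  "corolla g = Node g (Leaf 1) (Leaf 2) (Leaf 3)"

definition com :: "arrangement \<Rightarrow> (comtrans_gen tree \<Rightarrow>\<^sub>0 'k::field)" where
  "com p = Poly_Mapping.single (corolla (Commutator, p)) 1"

definition trl :: "arrangement \<Rightarrow> (comtrans_gen tree \<Rightarrow>\<^sub>0 'k::field)" where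
  "trl p = Poly_Mapping.single (corolla (Translator, p)) 1"

definition comtrans_basis :: "(comtrans_gen tree \<Rightarrow>\<^sub>0 'k::field) list" where
  "comtrans_basis =
     [trl XYZ + trl ZYX + com YXZ - com ZYX,
      trl XZY - trl ZXY + trl ZYX + com YXZ + com ZXY,
      trl YXZ + trl ZXY - com YXZ - com ZXY,
      trl YZX + trl ZXY - trl ZYX - com YXZ + com ZYX,
      com XYZ + com YXZ,
      com XZY + com ZXY,
      com YZX + com ZYX]"

end

theory Submission
  imports Defs
begin

text \<open>
  The comtrans relations are linear in the generating operations. Together with their images under
  the symmetric group they span a seven-dimensional subspace of the twelve-dimensional space of
  generators of the shuffle operad, and the seven elements are its reduced echelon basis. Solving
  each of them for its leading generator gives a projection of the generators onto the span of the
  other five, and applying this projection to all vertices of a tree simultaneously gives a normal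
  form. Two properties of the normal form prove the theorem. It annihilates the ideal, and the normal
  form of a monomial involves only that monomial and smaller ones, while a monomial without leading
  generators is its own normal form. Hence the leading monomial of a nonzero element of the ideal cannot
  consist of the five remaining generators alone: its coefficient would survive in the normal form. It
  contains a vertex labelled by a leading generator, which is divisibility by the corresponding
  corolla (\<open>leading_monomial_not_normal\<close>).

  The normal form is represented by its coefficient functionals \<open>coeff m\<close>, defined directly on
  symmetric monomials. Such a functional vanishes on every relation placed at
  a vertex of a tree (\<open>satisfies_relations_coeff_context\<close>). The polynomials annihilated by all
  functions with this property form a symmetric ideal that contains the relations
  (\<open>sym_ideal_functional_kernel\<close>, \<open>comtrans_relations_in_functional_kernel\<close>), and therefore
  contains the comtrans ideal. That the normal form does not create greater monomials is
  \<open>coeff_eq_0_if_less\<close>.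

  Two general facts are needed besides. Forgetting the symmetries of an ideal yields a shuffle ideal,
  because a shuffle composition is a partial composition followed by a permutation
  (\<open>shuffle_graft_eq_relabel_graft\<close>). And the path order is total on each arity, so that leading
  monomials exist, because the words read along the paths to the leaves, taken from left to right,
  determine a planar tree (\<open>leaf_paths_inj_aux\<close>).
\<close>

section \<open>Pairing polynomials with functions on monomials\<close>

text \<open>
  All identities and memberships between polynomials are tested against functions on monomials:
  these separate polynomials (lemma \<open>pair_eqI\<close>), and pairing turns the extensions of maps of
  monomials into composition of functions, so no sum over keys has to be manipulated again.
\<close>

definition pair :: "('a \<Rightarrow> 'k::field) \<Rightarrow> ('a \<Rightarrow>\<^sub>0 'k) \<Rightarrow> 'k" where
  "pair \<phi> f = (\<Sum>s\<in>Poly_Mapping.keys f. Poly_Mapping.lookup f s * \<phi> s)"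

lemma pair_superset:
  assumes "finite A" "Poly_Mapping.keys f \<subseteq> A"
  shows "pair \<phi> f = (\<Sum>s\<in>A. Poly_Mapping.lookup f s * \<phi> s)"
  unfolding pair_def by (rule sum.mono_neutral_left) (use assms in \<open>auto simp: in_keys_iff\<close>)

lemma pair_zero [simp]: "pair \<phi> 0 = 0"
  by (simp add: pair_def)

lemma pair_single [simp]: "pair \<phi> (Poly_Mapping.single t c) = c * \<phi> t"
  by (simp add: pair_def)

lemma pair_add [simp]: "pair \<phi> (f + g) = pair \<phi> f + pair \<phi> g"
proof -
  let ?A = "Poly_Mapping.keys f \<union> Poly_Mapping.keys g"
  have "Poly_Mapping.keys (f + g) \<subseteq> ?A" by (rule Poly_Mapping.keys_add)
  then show ?thesis
    by (simp add: pair_superset[of ?A] lookup_add distrib_right sum.distrib)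
qed

lemma pair_diff [simp]: "pair \<phi> (f - g) = pair \<phi> f - pair \<phi> g"
  using pair_add[of \<phi> "f - g" g] by simp

lemma pair_sum [simp]: "pair \<phi> (\<Sum>x\<in>A. F x) = (\<Sum>x\<in>A. pair \<phi> (F x))"
  by (induction A rule: infinite_finite_induct) auto

lemma lookup_scale [simp]: "Poly_Mapping.lookup (scale c f) t = c * Poly_Mapping.lookup f t"
  by (auto simp: scale_def Poly_Mapping.map.rep_eq when_def)

lemma keys_scale: "Poly_Mapping.keys (scale c f) \<subseteq> Poly_Mapping.keys f"
  by (auto simp: in_keys_iff)

lemma pair_scale [simp]: "pair \<phi> (scale c f) = c * pair \<phi> f"
  by (simp add: pair_superset[OF finite_keys keys_scale, of \<phi>] pair_superset[OF finite_keys order.refl, of _ f]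
      sum_distrib_left mult.assoc)

lemma pair_linear_ext [simp]: "pair \<phi> (linear_ext h f) = pair (\<lambda>s. \<phi> (h s)) f"
  by (simp add: linear_ext_def pair_def[of _ f])

lemma pair_bilinear_ext:
  "pair \<phi> (bilinear_ext h f g) = pair (\<lambda>s. pair (\<lambda>t. \<phi> (h s t)) g) f"
  by (simp add: bilinear_ext_def pair_def[of _ f] pair_def[of _ g] sum_distrib_left mult.assoc)

lemma pair_swap:
  "pair (\<lambda>s. pair (\<lambda>t. F s t) g) f = pair (\<lambda>t. pair (\<lambda>s. F s t) f) g"
  unfolding pair_def sum_distrib_left
  by (subst sum.swap) (simp add: mult.left_commute)

lemma pair_cong:
  "(\<And>s. s \<in> Poly_Mapping.keys f \<Longrightarrow> \<phi> s = \<psi> s) \<Longrightarrow> pair \<phi> f = pair \<psi> f"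
  by (simp add: pair_def)

lemma lookup_eq_pair: "Poly_Mapping.lookup f t = pair (\<lambda>s. of_bool (s = t)) f"
  by (simp add: pair_def of_bool_def if_distrib sum.delta in_keys_iff cong: if_cong)

lemma pair_eqI: "(\<And>\<phi>. pair \<phi> f = pair \<phi> g) \<Longrightarrow> f = g"
  by (rule poly_mapping_eqI) (simp add: lookup_eq_pair)

lemma linear_ext_add: "linear_ext h (f + g) = linear_ext h f + linear_ext h g"
  by (rule pair_eqI) simp

lemma linear_ext_diff: "linear_ext h (f - g) = linear_ext h f - linear_ext h g"
  by (rule pair_eqI) simp

lemma linear_ext_scale: "linear_ext h (scale c f) = scale c (linear_ext h f)"
  by (rule pair_eqI) simp

lemma linear_ext_zero: "linear_ext h 0 = 0"
  by (rule pair_eqI) simp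

lemma linear_ext_single:
  "linear_ext h (Poly_Mapping.single t c) = Poly_Mapping.single (h t) c"
  by (rule pair_eqI) simp

lemma keys_linear_ext: "Poly_Mapping.keys (linear_ext h f) \<subseteq> h ` Poly_Mapping.keys f"
  unfolding linear_ext_def
  by (rule order.trans[OF keys_sum]) auto

lemma keys_bilinear_ext:
  "Poly_Mapping.keys (bilinear_ext h f g) \<subseteq>
     {h s t | s t. s \<in> Poly_Mapping.keys f \<and> t \<in> Poly_Mapping.keys g}"
proof
  fix x assume "x \<in> Poly_Mapping.keys (bilinear_ext h f g)"
  then obtain s t where "s \<in> Poly_Mapping.keys f" "t \<in> Poly_Mapping.keys g"
    "x \<in> Poly_Mapping.keys (Poly_Mapping.single (h s t)
             (Poly_Mapping.lookup f s * Poly_Mapping.lookup g t))"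
    unfolding bilinear_ext_def by (blast dest!: subsetD[OF keys_sum])
  then show "x \<in> {h s t | s t. s \<in> Poly_Mapping.keys f \<and> t \<in> Poly_Mapping.keys g}"
    by (auto split: if_splits)
qed

lemma is_subspace_supported: "is_subspace {f. Poly_Mapping.keys f \<subseteq> S}"
  unfolding is_subspace_def
  by (auto dest!: subsetD[OF keys_scale] subsetD[OF Poly_Mapping.keys_add])

lemma is_subspace_add: "is_subspace V \<Longrightarrow> f \<in> V \<Longrightarrow> g \<in> V \<Longrightarrow> f + g \<in> V"
  by (simp add: is_subspace_def)

lemma is_subspace_diff:
  assumes "is_subspace V" "f \<in> V" "g \<in> V"
  shows "f - g \<in> V"
proof -
  have e: "f - g = f + scale (-1) g" by (rule pair_eqI) simp
  show ?thesis unfolding e using assms by (auto simp: is_subspace_def)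
qed

section \<open>The path order\<close>

lemma list_all2_imp_lenlex:
  "list_all2 (\<lambda>x y. x = y \<or> (x, y) \<in> r) xs ys \<Longrightarrow> xs = ys \<or> (xs, ys) \<in> lenlex r"
  by (induction rule: list_all2_induct) (auto simp: Cons_lenlex_iff dest: list_all2_lengthD lenlex_length)

text \<open>
  The paths to the leaves, from left to right, form a code for planar trees in which no codeword is
  a prefix of another. This is why path sequence and leaf order together determine a tree.
\<close>

fun leaf_paths :: "'g tree \<Rightarrow> ('g list \<times> nat) list" where
  "leaf_paths (Leaf i) = [([], i)]"
| "leaf_paths (Node g a b c) =
     map (map_prod ((#) g) id) (leaf_paths a @ leaf_paths b @ leaf_paths c)"

lemma leaf_paths_eq:
  "distinct (leaves t) \<Longrightarrow> leaf_paths t = map (\<lambda>i. (path i t, i)) (leaves t)"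
proof (induction t)
  case (Node g a b c)
  then show ?case by (auto simp: disjoint_iff)
qed simp

lemma leaf_paths_ne [simp]: "leaf_paths t \<noteq> []"
  by (induction t) auto

text \<open>
  The common prefix \<open>w\<close> and the remainders \<open>X\<close> and \<open>Y\<close> describe the position of a parser
  inside a larger tree: with them the three subtrees of a vertex can be split off one after the other.
\<close>

lemma leaf_paths_inj_aux:
  assumes "map (map_prod ((@) w) id) (leaf_paths s) @ X = map (map_prod ((@) w) id) (leaf_paths t) @ Y"
  shows "s = t"
  using assms
proof (induction s arbitrary: t w X Y)
  case (Leaf i)
  show ?case
  proof (cases t)
    case (Leaf j)
    then show ?thesis using Leaf.prems by simp
  next
    case (Node g a b c)
    then show ?thesis using Leaf.prems by (cases "leaf_paths a") auto
  qed
next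
  case (Node g a b c)
  show ?case
  proof (cases t)
    case (Leaf j)
    then show ?thesis using Node.prems by (cases "leaf_paths a") auto
  next
    case t: (Node g' a' b' c')
    have [simp]: "map (map_prod ((@) w) (\<lambda>a. a) \<circ> map_prod ((#) h) (\<lambda>a. a)) xs = map (map_prod ((@) (w @ [h])) (\<lambda>a. a)) xs"
      for h and xs :: "('a list \<times> nat) list"
      by auto
    have g: "g = g'"
      using Node.prems t by (cases "leaf_paths a"; cases "leaf_paths a'") auto
    let ?P = "\<lambda>t. map (map_prod ((@) (w @ [g])) id) (leaf_paths t)"
    have e: "?P a @ ?P b @ ?P c @ X = ?P a' @ ?P b' @ ?P c' @ Y"
      using Node.prems t g by (simp add: id_def)
    have a: "a = a'" using Node.IH(1)[OF e] .
    then have e: "?P b @ ?P c @ X = ?P b' @ ?P c' @ Y" using e by simp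
    have b: "b = b'" using Node.IH(2)[OF e] .
    then have e: "?P c @ X = ?P c' @ Y" using e by simp
    have "c = c'" using Node.IH(3)[OF e] .
    with a b g t show ?thesis by simp
  qed
qed

lemma tree_eqI:
  assumes "distinct (leaves s)" "leaves s = leaves t"
    "\<And>i. i \<in> set (leaves s) \<Longrightarrow> path i s = path i t"
  shows "s = t"
proof -
  have "leaf_paths s = leaf_paths t"
    using assms by (simp add: leaf_paths_eq)
  then show ?thesis by (intro leaf_paths_inj_aux[of "[]" _ "[]" _ "[]"]) simp
qed

lemma arity_sym_monomials: "t \<in> sym_monomials n \<Longrightarrow> arity t = n"
  by (auto simp: sym_monomials_def dest: distinct_card)

text \<open>
  Totality on the monomials of one arity is what makes the leading monomial of a nonzero polynomial
  exist.
\<close>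

lemma path_deglex_total:
  assumes "total r" "s \<in> sym_monomials n" "t \<in> sym_monomials n" "s \<noteq> t"
  shows "(s, t) \<in> path_deglex r \<or> (t, s) \<in> path_deglex r"
proof (cases "path_sequence s = path_sequence t")
  case False
  have "total (lenlex (lenlex r))" using assms(1) by (intro total_lenlex)
  then show ?thesis using False by (auto simp: path_deglex_def total_on_def)
next
  case True
  have n: "arity s = n" "arity t = n" using assms arity_sym_monomials by auto
  have "path i s = path i t" if "i \<in> set (leaves s)" for i
  proof -
    have "i \<in> set [1..<Suc n]" using that assms(2) by (auto simp: sym_monomials_def)
    then show ?thesis
      using True unfolding path_sequence_def n map_eq_conv by blast
  qed
  then have "leaves s \<noteq> leaves t"
    using tree_eqI[of s t] assms by (auto simp: sym_monomials_def)
  moreover have "total (lenlex less_than)" by (intro total_lenlex) auto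
  ultimately have "(leaves s, leaves t) \<in> lenlex less_than \<or> (leaves t, leaves s) \<in> lenlex less_than"
    by (auto simp: total_on_def)
  then show ?thesis using True n by (auto simp: path_deglex_def lenlex_conv)
qed

lemma trans_path_deglex: "trans r \<Longrightarrow> trans (path_deglex r)"
proof (rule transI)
  fix s t u assume r: "trans r" and "(s, t) \<in> path_deglex r" "(t, u) \<in> path_deglex r"
  moreover have "trans (lenlex (lenlex r))" using r by (intro lenlex_transI)
  moreover have "trans (lex less_than)" by (intro lex_transI) auto
  ultimately show "(s, u) \<in> path_deglex r"
    unfolding path_deglex_def by (auto dest: transD)
qed

lemma path_deglex_irrefl: "irrefl r \<Longrightarrow> (t, t) \<notin> path_deglex r"
proof -
  assume "irrefl r"
  then have "(xs, xs) \<notin> lenlex (lenlex r)" for xs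
    by (intro lenlex_irreflexive) (auto simp: irrefl_def)
  moreover have "irrefl (lex less_than)" by (intro irrefl_lex) (auto simp: irrefl_def)
  ultimately show ?thesis by (auto simp: path_deglex_def irrefl_def)
qed

lemma finite_has_greatest:
  assumes "finite A" "A \<noteq> {}" "trans r" "total_on A r"
  shows "\<exists>t\<in>A. \<forall>s\<in>A. s \<noteq> t \<longrightarrow> (s, t) \<in> r"
  using assms(1,2,4)
proof (induction rule: finite_ne_induct)
  case (insert x F)
  then obtain t where t: "t \<in> F" "\<forall>s\<in>F. s \<noteq> t \<longrightarrow> (s, t) \<in> r"
    by (auto simp: total_on_def)
  have "(x, t) \<in> r \<or> (t, x) \<in> r" using insert t by (auto simp: total_on_def)
  then show ?case
  proof
    assume "(t, x) \<in> r"
    then have "\<forall>s\<in>F. (s, x) \<in> r" using t assms(3) by (metis transD)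
    then show ?thesis by auto
  qed (use t in auto)
qed auto

lemma leading_monomial_eqI:
  assumes "trans r" "irrefl r" "t \<in> Poly_Mapping.keys f"
    "\<And>s. s \<in> Poly_Mapping.keys f \<Longrightarrow> s \<noteq> t \<Longrightarrow> (s, t) \<in> r"
  shows "leading_monomial r f = t"
  unfolding leading_monomial_def
proof (rule the_equality)
  fix u assume u: "u \<in> Poly_Mapping.keys f \<and> (\<forall>s\<in>Poly_Mapping.keys f. s \<noteq> u \<longrightarrow> (s, u) \<in> r)"
  show "u = t"
  proof (rule ccontr)
    assume "u \<noteq> t"
    then have "(u, t) \<in> r" "(t, u) \<in> r" using u assms by auto
    then show False using assms(1,2) by (metis irrefl_def transD)
  qed
qed (use assms in auto)

section \<open>Substitution\<close>

lemma subst_subst: "subst \<tau> (subst \<rho> t) = subst (\<lambda>j. subst \<tau> (\<rho> j)) t"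
  by (induction t) auto

lemma subst_cong: "(\<And>j. j \<in> set (leaves t) \<Longrightarrow> \<tau> j = \<rho> j) \<Longrightarrow> subst \<tau> t = subst \<rho> t"
  by (induction t) auto

lemma leaves_subst: "leaves (subst \<tau> t) = concat (map (\<lambda>j. leaves (\<tau> j)) (leaves t))"
  by (induction t) auto

lemma leaves_ne [simp]: "leaves t \<noteq> []"
  by (induction t) auto

lemma leaves_relabel [simp]: "leaves (relabel r t) = map r (leaves t)"
  by (simp add: relabel_def leaves_subst concat_map_singleton)

lemma set_leaves_realize [simp]: "set (leaves (realize t)) = set (leaves t)"
proof (induction t)
  case (Node g a b c)
  then show ?case by (cases "snd g") auto
qed simp

lemma arity_realize [simp]: "arity (realize t) = arity t"
proof (induction t)
  case (Node g a b c)
  then show ?case by (cases "snd g") auto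
qed simp

lemma min_leaf_realize [simp]: "min_leaf (realize t) = min_leaf t"
  by (simp add: min_leaf_def)

lemma realize_sym_monomials: "t \<in> sym_monomials n \<Longrightarrow> realize t \<in> sym_monomials n"
  by (auto simp: sym_monomials_def distinct_card intro!: card_distinct)

lemma realize_subst: "realize (subst \<tau> t) = subst (\<lambda>j. realize (\<tau> j)) (realize t)"
proof (induction t)
  case (Node g a b c)
  then show ?case by (cases "snd g") auto
qed simp

lemma realize_relabel: "realize (relabel r t) = relabel r (realize t)"
  by (simp add: relabel_def realize_subst)

lemma realize_shuffle_graft:
  "realize (shuffle_graft i v u s t) = shuffle_graft i v u (realize s) (realize t)"
  unfolding shuffle_graft_def realize_subst
  by (rule subst_cong) (simp add: realize_relabel)

lemma relabel_sym_monomials: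
  assumes "\<sigma> permutes {1..n}" "t \<in> sym_monomials n"
  shows "relabel \<sigma> t \<in> sym_monomials n"
  using assms permutes_image[OF assms(1)] permutes_inj_on[OF assms(1)]
  by (simp add: sym_monomials_def distinct_map)

text \<open>
  The inner monomial has at least one input: otherwise the \<open>n\<close> distinct values of \<open>v\<close> would have
  to lie among \<open>n - 1\<close> numbers.
\<close>

lemma shuffle_renumberingD:
  assumes "shuffle_renumbering n m i v u"
  shows "i \<in> {1..n}" "strict_mono_on {1..n} v" "strict_mono_on {1..m} u" "v i = u 1"
    "v ` {1..n} \<union> u ` {1..m} = {1..n + m - 1}" "m \<ge> 1"
proof -
  show i: "i \<in> {1..n}" and v: "strict_mono_on {1..n} v" and "strict_mono_on {1..m} u" "v i = u 1"
    and un: "v ` {1..n} \<union> u ` {1..m} = {1..n + m - 1}"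
    using assms by (auto simp: shuffle_renumbering_def)
  show "m \<ge> 1"
  proof (rule ccontr)
    assume "\<not> m \<ge> 1"
    then have "v ` {1..n} = {1..n - 1}" using un by (simp add: not_le)
    moreover have "card (v ` {1..n}) = n"
      using v by (simp add: card_image strict_mono_on_imp_inj_on)
    ultimately show False using i by simp
  qed
qed

lemma shuffle_renumbering_union:
  assumes "shuffle_renumbering n m i v u"
  shows "v ` ({1..n} - {i}) \<union> u ` {1..m} = {1..n + m - 1}"
proof -
  have "v i \<in> u ` {1..m}"
    using shuffle_renumberingD(4,6)[OF assms] by simp
  moreover have "v ` {1..n} = insert (v i) (v ` ({1..n} - {i}))"
    using shuffle_renumberingD(1)[OF assms] by blast
  ultimately have "v ` {1..n} \<union> u ` {1..m} = v ` ({1..n} - {i}) \<union> u ` {1..m}" by blast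
  then show ?thesis using shuffle_renumberingD(5)[OF assms] by simp
qed

lemma set_shuffle_graft:
  assumes "i \<in> set (leaves s)"
  shows "set (leaves (shuffle_graft i v u s t)) = v ` (set (leaves s) - {i}) \<union> u ` set (leaves t)"
  using assms by (auto simp: shuffle_graft_def leaves_subst split: if_splits)

lemma arity_shuffle_graft:
  assumes "distinct (leaves s)" "i \<in> set (leaves s)"
  shows "arity (shuffle_graft i v u s t) = arity s + arity t - 1"
proof -
  let ?k = "\<lambda>j. if j = i then arity t else 1"
  have "arity (shuffle_graft i v u s t) = sum_list (map ?k (leaves s))"
    by (auto simp: shuffle_graft_def leaves_subst length_concat o_def intro!: arg_cong[of _ _ sum_list])
  also have "\<dots> = (\<Sum>j\<in>set (leaves s). ?k j)"
    using assms(1) by (rule sum_list_distinct_conv_sum_set)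
  also have "\<dots> = arity t + (\<Sum>j\<in>set (leaves s) - {i}. ?k j)"
    using assms(2) by (subst sum.remove[of _ i]) auto
  also have "(\<Sum>j\<in>set (leaves s) - {i}. ?k j) = card (set (leaves s) - {i})"
    by simp
  also have "\<dots> = arity s - 1"
    using assms by (simp add: distinct_card)
  finally show ?thesis by (simp add: Suc_leI)
qed

text \<open>
  Distinctness of the leaf labels follows from counting: there are as many leaves as labels.
\<close>

lemma shuffle_graft_sym_monomials:
  assumes "shuffle_renumbering n m i v u" "s \<in> sym_monomials n" "t \<in> sym_monomials m"
  shows "shuffle_graft i v u s t \<in> sym_monomials (n + m - 1)"
proof -
  have s: "distinct (leaves s)" "set (leaves s) = {1..n}" "i \<in> set (leaves s)"
    and t: "set (leaves t) = {1..m}"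
    using assms shuffle_renumberingD(1)[OF assms(1)] by (auto simp: sym_monomials_def)
  have "set (leaves (shuffle_graft i v u s t)) = {1..n + m - 1}"
    using set_shuffle_graft[OF s(3), of v u t] shuffle_renumbering_union[OF assms(1)] s t by simp
  moreover have "arity (shuffle_graft i v u s t) = n + m - 1"
    using arity_shuffle_graft[OF s(1,3)] assms by (simp add: arity_sym_monomials)
  ultimately show ?thesis by (simp add: sym_monomials_def card_distinct)
qed

lemma strict_mono_on_Min:
  fixes v :: "nat \<Rightarrow> nat"
  assumes "strict_mono_on A v" "finite B" "B \<noteq> {}" "B \<subseteq> A"
  shows "Min (v ` B) = v (Min B)"
proof (rule Min_eqI)
  have "mono_on A v" using assms(1) by (rule strict_mono_on_imp_mono_on)
  moreover have "Min B \<in> A" using Min_in[OF assms(2,3)] assms(4) by blast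
  ultimately show "v (Min B) \<le> y" if "y \<in> v ` B" for y
    using that assms(2-4) by (auto intro!: mono_onD[of A v] Min_le)
qed (use assms in auto)

lemma min_leaf_in [simp]: "min_leaf t \<in> set (leaves t)"
  by (simp add: min_leaf_def)

lemma min_leaf_sym_monomials: "t \<in> sym_monomials m \<Longrightarrow> min_leaf t = 1"
proof -
  assume "t \<in> sym_monomials m"
  then have t: "set (leaves t) = {1..m}" by (simp add: sym_monomials_def)
  then have "m \<ge> 1" using min_leaf_in[of t] by (metis atLeastAtMost_iff order.trans)
  then show ?thesis by (auto simp: min_leaf_def t intro!: Min_eqI)
qed

lemma min_leaf_relabel:
  assumes "strict_mono_on (set (leaves t)) u"
  shows "min_leaf (relabel u t) = u (min_leaf t)"
  using strict_mono_on_Min[OF assms] by (simp add: min_leaf_def)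

lemma min_leaf_subst:
  assumes "strict_mono_on A v" "set (leaves s) \<subseteq> A" "\<And>j. j \<in> set (leaves s) \<Longrightarrow> min_leaf (\<tau> j) = v j"
  shows "min_leaf (subst \<tau> s) = v (min_leaf s)"
  using assms(2,3)
proof (induction s)
  case (Node g a b c)
  have *: "min_leaf (Node h x y z) = min (min_leaf x) (min (min_leaf y) (min_leaf z))"
    for h and x y z :: "'z tree"
    by (simp add: min_leaf_def Min_Un)
  have mono: "v (min p q) = min (v p) (v q)" if "p \<in> A" "q \<in> A" for p q
    using that strict_mono_on_less_eq[OF assms(1)] by (auto simp: min_def)
  have "min_leaf a \<in> A" "min_leaf b \<in> A" "min_leaf c \<in> A" "min (min_leaf b) (min_leaf c) \<in> A"
    using Node.prems(1) min_leaf_in[of a] min_leaf_in[of b] min_leaf_in[of c] by (auto simp: min_def)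
  then show ?case using Node by (simp add: * mono)
qed (simp add: min_leaf_def)

text \<open>
  Grafting respects the shuffle condition as long as the minimal leaves of the grafted trees are
  ordered like the inputs that they replace, since the condition only compares minimal leaves.
\<close>

lemma is_shuffle_subst:
  assumes "strict_mono_on A v" "set (leaves s) \<subseteq> A" "\<And>j. j \<in> set (leaves s) \<Longrightarrow> min_leaf (\<tau> j) = v j"
    "\<And>j. j \<in> set (leaves s) \<Longrightarrow> is_shuffle (\<tau> j)" "is_shuffle s"
  shows "is_shuffle (subst \<tau> s)"
  using assms(2-)
proof (induction s)
  case (Node g a b c)
  have A: "min_leaf a \<in> A" "min_leaf b \<in> A" "min_leaf c \<in> A"
    using Node.prems(1) min_leaf_in[of a] min_leaf_in[of b] min_leaf_in[of c] by auto
  have "min_leaf (subst \<tau> a) = v (min_leaf a)" "min_leaf (subst \<tau> b) = v (min_leaf b)"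
    "min_leaf (subst \<tau> c) = v (min_leaf c)"
    using Node.prems by (auto intro!: min_leaf_subst[OF assms(1)])
  then show ?case
    using Node A strict_mono_on_less[OF assms(1)] by auto
qed simp

lemma shuffle_graft_shuffle_monomials:
  assumes "shuffle_renumbering n m i v u" "s \<in> shuffle_monomials n" "t \<in> shuffle_monomials m"
  shows "shuffle_graft i v u s t \<in> shuffle_monomials (n + m - 1)"
proof -
  note D = shuffle_renumberingD[OF assms(1)]
  have s: "s \<in> sym_monomials n" "is_shuffle s" "set (leaves s) = {1..n}"
    and t: "t \<in> sym_monomials m" "is_shuffle t" "set (leaves t) = {1..m}"
    using assms by (auto simp: shuffle_monomials_def sym_monomials_def)
  have "min_leaf (relabel u t) = v i"
    using D t min_leaf_sym_monomials[OF t(1)] by (simp add: min_leaf_relabel)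
  moreover have "is_shuffle (relabel u t)"
    unfolding relabel_def
    by (rule is_shuffle_subst[of "{1..m}" u]) (use D t in \<open>auto simp: min_leaf_def\<close>)
  ultimately have "is_shuffle (shuffle_graft i v u s t)"
    unfolding shuffle_graft_def
    by (intro is_shuffle_subst[of "{1..n}" v]) (use D s in \<open>auto simp: min_leaf_def\<close>)
  then show ?thesis
    using shuffle_graft_sym_monomials[OF assms(1) s(1) t(1)] by (simp add: shuffle_monomials_def)
qed

text \<open>
  A partial composition of the symmetric operad is the shuffle composition for the block
  renumbering, in which the inputs of the inner monomial are consecutive. Every statement about
  \<^const>\<open>graft\<close> is derived from one about \<^const>\<open>shuffle_graft\<close> in this way. The renumbering of
  the outer inputs depends on the arity \<open>m\<close> of the inner monomial.
\<close>

definition block_outer :: "nat \<Rightarrow> nat \<Rightarrow> nat \<Rightarrow> nat" where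
  "block_outer i m j = (if j \<le> i then j else j + m - 1)"

definition block_inner :: "nat \<Rightarrow> nat \<Rightarrow> nat" where
  "block_inner i l = l + i - 1"

lemma shuffle_renumbering_block:
  assumes "i \<in> {1..n}" "m \<ge> 1"
  shows "shuffle_renumbering n m i (block_outer i m) (block_inner i)"
proof -
  have "x \<in> block_outer i m ` {1..n} \<union> block_inner i ` {1..m}" if "x \<in> {1..n + m - 1}" for x
  proof -
    consider "x \<le> i" | "i < x" "x \<le> i + m - 1" | "i + m - 1 < x" by linarith
    then show ?thesis
    proof cases
      case 1
      then have "x = block_outer i m x" "x \<in> {1..n}" using that assms by (auto simp: block_outer_def)
      then show ?thesis by blast
    next
      case 2
      then have "x = block_inner i (x - i + 1)" "x - i + 1 \<in> {1..m}"
        using that assms by (auto simp: block_inner_def)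
      then show ?thesis by blast
    next
      case 3
      then have "x = block_outer i m (x - (m - 1))" "x - (m - 1) \<in> {1..n}"
        using that assms by (auto simp: block_outer_def)
      then show ?thesis by blast
    qed
  qed
  moreover have "block_outer i m ` {1..n} \<union> block_inner i ` {1..m} \<subseteq> {1..n + m - 1}"
    using assms by (auto simp: block_outer_def block_inner_def)
  ultimately have "block_outer i m ` {1..n} \<union> block_inner i ` {1..m} = {1..n + m - 1}" by blast
  then show ?thesis
    using assms by (auto simp: shuffle_renumbering_def strict_mono_on_def block_outer_def block_inner_def)
qed

lemma graft_eq_shuffle_graft:
  "graft i s t = shuffle_graft i (block_outer i (arity t)) (block_inner i) s t"
  by (auto simp: graft_def shuffle_graft_def block_outer_def block_inner_def relabel_def intro!: subst_cong)

lemma bilinear_graft_eq: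
  assumes "g \<in> sym_operad m"
  shows "bilinear_ext (graft i) f g =
    bilinear_ext (shuffle_graft i (block_outer i m) (block_inner i)) f g"
proof (rule pair_eqI)
  fix \<phi> :: "'a tree \<Rightarrow> 'b"
  have "arity t = m" if "t \<in> Poly_Mapping.keys g" for t
    using that assms by (auto simp: sym_operad_def intro: arity_sym_monomials)
  then show "pair \<phi> (bilinear_ext (graft i) f g) =
    pair \<phi> (bilinear_ext (shuffle_graft i (block_outer i m) (block_inner i)) f g)"
    unfolding pair_bilinear_ext
    by (intro pair_cong) (simp add: graft_eq_shuffle_graft)
qed

lemma sym_operad_bilinear_graft:
  assumes "i \<in> {1..n}" "f \<in> sym_operad n" "g \<in> sym_operad m"
  shows "bilinear_ext (graft i) f g \<in> sym_operad (n + m - 1)"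
proof -
  have "graft i s t \<in> sym_monomials (n + m - 1)"
    if st: "s \<in> Poly_Mapping.keys f" "t \<in> Poly_Mapping.keys g" for s t
  proof -
    have t: "t \<in> sym_monomials m" and s: "s \<in> sym_monomials n"
      using st assms by (auto simp: sym_operad_def)
    then have m: "arity t = m" by (simp add: arity_sym_monomials)
    then have "m \<ge> 1" by (metis One_nat_def Suc_leI leaves_ne length_greater_0_conv)
    then show ?thesis
      unfolding graft_eq_shuffle_graft m
      using shuffle_graft_sym_monomials[OF shuffle_renumbering_block[OF assms(1)] s t] by simp
  qed
  then show ?thesis
    using keys_bilinear_ext[of "graft i" f g] unfolding sym_operad_def by blast
qed

lemma is_subspace_sym_operad: "is_subspace (sym_operad n)"
  unfolding sym_operad_def by (rule is_subspace_supported)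

lemma sym_operad_relabel:
  assumes "\<sigma> permutes {1..n}" "f \<in> sym_operad n"
  shows "linear_ext (relabel \<sigma>) f \<in> sym_operad n"
  using keys_linear_ext[of "relabel \<sigma>" f] relabel_sym_monomials[OF assms(1)] assms(2)
  unfolding sym_operad_def by blast

section \<open>Forgetting the symmetries of an ideal\<close>

text \<open>
  Conversely, a shuffle composition is a partial composition followed by the permutation that
  moves the block of inner inputs to the labels prescribed by \<open>u\<close> and the other inputs to the labels
  prescribed by \<open>v\<close>.
\<close>

lemma shuffle_graft_eq_relabel_graft:
  assumes "shuffle_renumbering n m i v u"
  obtains \<sigma> where "\<sigma> permutes {1..n + m - 1}"
    "\<And>s t. s \<in> sym_monomials n \<Longrightarrow> t \<in> sym_monomials m \<Longrightarrow>
        shuffle_graft i v u s t = relabel \<sigma> (graft i s t)"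
proof
  note D = shuffle_renumberingD[OF assms]
  \<comment> \<open>The block of inner inputs is \<open>{i..i + m - 1}\<close>.\<close>
  define \<sigma> where "\<sigma> j = (if j \<notin> {1..n + m - 1} then j else if j < i then v j
      else if j \<le> i + m - 1 then u (j - i + 1) else v (j - (m - 1)))" for j
  have outer: "\<sigma> (block_outer i m j) = v j" if "j \<in> {1..n} - {i}" for j
    using that D(1,6) by (auto simp: \<sigma>_def block_outer_def)
  have inner: "\<sigma> (block_inner i l) = u l" if "l \<in> {1..m}" for l
    using that D(1,6) by (auto simp: \<sigma>_def block_inner_def)
  have block: "shuffle_renumbering n m i (block_outer i m) (block_inner i)"
    using D(1,6) by (rule shuffle_renumbering_block)
  have "\<sigma> ` {1..n + m - 1} =
      (\<lambda>j. \<sigma> (block_outer i m j)) ` ({1..n} - {i}) \<union> (\<lambda>l. \<sigma> (block_inner i l)) ` {1..m}"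
    unfolding shuffle_renumbering_union[OF block, symmetric] by (simp only: image_Un image_image)
  also have "\<dots> = v ` ({1..n} - {i}) \<union> u ` {1..m}"
    by (intro arg_cong2[of _ _ _ _ "(\<union>)"] image_cong refl outer inner)
  also have "\<dots> = {1..n + m - 1}"
    using assms by (rule shuffle_renumbering_union)
  finally have im: "\<sigma> ` {1..n + m - 1} = {1..n + m - 1}" .
  then have "inj_on \<sigma> {1..n + m - 1}"
    by (intro eq_card_imp_inj_on) auto
  with im show "\<sigma> permutes {1..n + m - 1}"
    by (intro bij_imp_permutes) (auto simp: bij_betw_def \<sigma>_def)
  fix s t :: "'c tree"
  assume s: "s \<in> sym_monomials n" and t: "t \<in> sym_monomials m"
  then have m: "arity t = m" by (simp add: arity_sym_monomials)
  have "relabel u t = relabel \<sigma> (relabel (block_inner i) t)"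
    unfolding relabel_def subst_subst
    using t inner by (intro subst_cong) (auto simp: sym_monomials_def)
  then show "shuffle_graft i v u s t = relabel \<sigma> (graft i s t)"
    unfolding graft_eq_shuffle_graft m shuffle_graft_def relabel_def[of \<sigma> "subst _ _"] subst_subst
    using s outer by (intro subst_cong) (auto simp: sym_monomials_def relabel_def)
qed

lemma linear_ext_realize_in_sym_operad:
  assumes "f \<in> shuffle_operad n"
  shows "linear_ext realize f \<in> sym_operad n"
  using assms keys_linear_ext[of realize f] realize_sym_monomials
  unfolding shuffle_operad_def sym_operad_def shuffle_monomials_def by blast

text \<open>
  A symmetric ideal is closed under partial compositions and permutations, hence under the
  composites of the two, and \<^const>\<open>realize\<close> commutes with grafting.
\<close>

lemma shuffle_ideal_forget_ideal:
  fixes J :: "nat \<Rightarrow> ('g tree \<Rightarrow>\<^sub>0 'k::field) set"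
  assumes J: "sym_ideal J"
  shows "shuffle_ideal (forget_ideal J)"
  unfolding shuffle_ideal_def
proof (intro conjI allI impI)
  fix n
  show "forget_ideal J n \<subseteq> shuffle_operad n" by (auto simp: forget_ideal_def)
  have "is_subspace (J n)" using J by (simp add: sym_ideal_def)
  moreover have "is_subspace (shuffle_operad n :: (('g \<times> arrangement) tree \<Rightarrow>\<^sub>0 'k) set)"
    unfolding shuffle_operad_def by (rule is_subspace_supported)
  ultimately show "is_subspace (forget_ideal J n)"
    by (auto simp: is_subspace_def forget_ideal_def linear_ext_add linear_ext_scale linear_ext_zero)
next
  fix n m i v u and f g :: "('g \<times> arrangement) tree \<Rightarrow>\<^sub>0 'k"
  assume *: "shuffle_renumbering n m i v u \<and> f \<in> shuffle_operad n \<and> g \<in> shuffle_operad m \<and>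
     (f \<in> forget_ideal J n \<or> g \<in> forget_ideal J m)"
  obtain \<sigma> where \<sigma>: "\<sigma> permutes {1..n + m - 1}"
    "\<And>s t :: 'g tree. s \<in> sym_monomials n \<Longrightarrow> t \<in> sym_monomials m \<Longrightarrow>
        shuffle_graft i v u s t = relabel \<sigma> (graft i s t)"
    using shuffle_graft_eq_relabel_graft * by metis
  let ?h = "bilinear_ext (shuffle_graft i v u) f g"
  let ?f = "linear_ext realize f" and ?g = "linear_ext realize g"
  have keys: "s \<in> shuffle_monomials n" "t \<in> shuffle_monomials m"
    if "s \<in> Poly_Mapping.keys f" "t \<in> Poly_Mapping.keys g" for s t
    using that * by (auto simp: shuffle_operad_def)
  have "realize (shuffle_graft i v u s t) = relabel \<sigma> (graft i (realize s) (realize t))"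
    if "s \<in> Poly_Mapping.keys f" "t \<in> Poly_Mapping.keys g" for s t
    using keys[OF that]
    by (simp add: realize_shuffle_graft \<sigma>(2) realize_sym_monomials shuffle_monomials_def)
  then have "linear_ext realize ?h = linear_ext (relabel \<sigma>) (bilinear_ext (graft i) ?f ?g)"
    by (intro pair_eqI) (simp add: pair_bilinear_ext cong: pair_cong)
  moreover have "bilinear_ext (graft i) ?f ?g \<in> J (n + m - 1)"
  proof -
    have "?f \<in> sym_operad n" "?g \<in> sym_operad m" "?f \<in> J n \<or> ?g \<in> J m" "i \<in> {1..n}"
      using * by (auto simp: linear_ext_realize_in_sym_operad forget_ideal_def dest: shuffle_renumberingD(1))
    then show ?thesis using J by (simp add: sym_ideal_def)
  qed
  ultimately have "linear_ext realize ?h \<in> J (n + m - 1)"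
    using \<sigma>(1) J by (simp add: sym_ideal_def)
  moreover have "?h \<in> shuffle_operad (n + m - 1)"
    using keys_bilinear_ext[of "shuffle_graft i v u" f g] keys shuffle_graft_shuffle_monomials *
    unfolding shuffle_operad_def by blast
  ultimately show "?h \<in> forget_ideal J (n + m - 1)" by (simp add: forget_ideal_def)
qed

text \<open>
  The intersection that defines the generated ideal must range over at least one ideal to
  stay inside the operad; \<open>K\<close> provides it.
\<close>

lemma sym_ideal_ideal_generated:
  assumes K: "sym_ideal K" "\<And>m. R m \<subseteq> K m"
  shows "sym_ideal (ideal_generated R)"
proof -
  have sub: "ideal_generated R n \<subseteq> K n" for n using K by (auto simp: ideal_generated_def)
  have Kn: "K n \<subseteq> sym_operad n" for n using K by (simp add: sym_ideal_def)
  show ?thesis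
    unfolding sym_ideal_def
  proof (intro conjI allI impI)
    fix n
    show "ideal_generated R n \<subseteq> sym_operad n" using sub Kn by blast
    have "is_subspace (J n)" if "sym_ideal J" for J :: "nat \<Rightarrow> ('a tree \<Rightarrow>\<^sub>0 'b) set"
      using that by (simp add: sym_ideal_def)
    then show "is_subspace (ideal_generated R n)"
      by (simp add: is_subspace_def ideal_generated_def)
  next
    fix n \<sigma> f assume *: "\<sigma> permutes {1..n} \<and> f \<in> ideal_generated R n"
    then have "linear_ext (relabel \<sigma>) f \<in> J n" if "sym_ideal J" "f \<in> J n" for J
      using that by (simp add: sym_ideal_def)
    then show "linear_ext (relabel \<sigma>) f \<in> ideal_generated R n"
      using * by (simp add: ideal_generated_def)
  next
    fix n m i f g
    assume *: "i \<in> {1..n} \<and> f \<in> sym_operad n \<and> g \<in> sym_operad m \<and>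
      (f \<in> ideal_generated R n \<or> g \<in> ideal_generated R m)"
    show "bilinear_ext (graft i) f g \<in> ideal_generated R (n + m - 1)"
      unfolding ideal_generated_def
    proof (intro CollectI allI impI)
      fix J assume J: "sym_ideal J \<and> (\<forall>m. R m \<subseteq> J m)"
      then have "f \<in> J n \<or> g \<in> J m" using * by (auto simp: ideal_generated_def)
      then show "bilinear_ext (graft i) f g \<in> J (n + m - 1)"
        using J * by (simp add: sym_ideal_def)
    qed
  qed
qed

lemma ideal_generated_in_ideal:
  assumes "f \<in> ideal_generated R n" "sym_ideal K" "\<And>m. R m \<subseteq> K m"
  shows "f \<in> K n"
  using assms by (simp add: ideal_generated_def)

lemma relations_in_ideal_generated: "f \<in> R n \<Longrightarrow> f \<in> ideal_generated R n"
  by (auto simp: ideal_generated_def)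

section \<open>Functionals that vanish on the comtrans ideal\<close>

abbreviation (input) "C x y z \<equiv> Node Commutator x y z"
abbreviation (input) "T x y z \<equiv> Node Translator x y z"

definition satisfies_relations ::
  "(comtrans_op tree \<Rightarrow> 'k::field) \<Rightarrow> comtrans_op tree \<Rightarrow> comtrans_op tree \<Rightarrow> comtrans_op tree \<Rightarrow> bool" where
  "satisfies_relations \<phi> a b c \<longleftrightarrow>
     \<phi> (C a b c) + \<phi> (C b a c) = 0 \<and>
     \<phi> (T a b c) + \<phi> (T b c a) + \<phi> (T c a b) = 0 \<and>
     \<phi> (C a b c) + \<phi> (C c b a) - \<phi> (T a b c) - \<phi> (T c b a) = 0"

inductive context_map :: "('g tree \<Rightarrow> 'g tree) \<Rightarrow> bool" where
  hole: "context_map (\<lambda>x. x)"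
| left: "context_map F \<Longrightarrow> context_map (\<lambda>x. Node g (F x) b c)"
| middle: "context_map F \<Longrightarrow> context_map (\<lambda>x. Node g a (F x) c)"
| right: "context_map F \<Longrightarrow> context_map (\<lambda>x. Node g a b (F x))"

text \<open>
  Arguments and contexts range over all trees, with any leaf labels, not only over the monomials of
  the operad; this makes the
  notion stable under arbitrary substitutions.
\<close>

definition comtrans_functional :: "(comtrans_op tree \<Rightarrow> 'k::field) \<Rightarrow> bool" where
  "comtrans_functional \<phi> \<longleftrightarrow>
     (\<forall>F a b c. context_map F \<longrightarrow> satisfies_relations (\<lambda>x. \<phi> (F x)) a b c)"

lemma context_map_compose:
  "context_map F \<Longrightarrow> context_map G \<Longrightarrow> context_map (\<lambda>x. F (G x))"
  by (induction rule: context_map.induct) (auto intro: context_map.intros)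

lemma subst_context:
  assumes "context_map F"
  shows "\<exists>G. context_map G \<and> (\<forall>x. subst \<tau> (F x) = G (subst \<tau> x))"
  using assms
proof induction
  case hole
  then show ?case using context_map.hole by fastforce
next
  case (left F g b c)
  then obtain G where "context_map G" "\<forall>x. subst \<tau> (F x) = G (subst \<tau> x)" by auto
  then show ?case
    using context_map.left[of G g "subst \<tau> b" "subst \<tau> c"] by (intro exI[of _ "\<lambda>x. Node g (G x) _ _"]) auto
next
  case (middle F g a c)
  then obtain G where "context_map G" "\<forall>x. subst \<tau> (F x) = G (subst \<tau> x)" by auto
  then show ?case
    using context_map.middle[of G g "subst \<tau> a" "subst \<tau> c"] by (intro exI[of _ "\<lambda>x. Node g _ (G x) _"]) auto
next
  case (right F g a b)
  then obtain G where "context_map G" "\<forall>x. subst \<tau> (F x) = G (subst \<tau> x)" by auto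
  then show ?case
    using context_map.right[of G g "subst \<tau> a" "subst \<tau> b"] by (intro exI[of _ "\<lambda>x. Node g _ _ (G x)"]) auto
qed

text \<open>
  As the labels of \<open>s\<close> are distinct, the input \<open>i\<close> occurs once, so grafting there is
  insertion into a context.
\<close>

lemma subst_single_hole:
  assumes "distinct (leaves s)" "i \<in> set (leaves s)"
  shows "\<exists>F. context_map F \<and> (\<forall>x. subst (\<lambda>j. if j = i then x else \<tau> j) s = F x)"
  using assms
proof (induction s)
  case (Leaf j)
  then show ?case using context_map.hole by (intro exI[of _ "\<lambda>x. x"]) auto
next
  case (Node g a b c)
  have outside: "subst (\<lambda>j. if j = i then x else \<tau> j) t = subst \<tau> t" if "i \<notin> set (leaves t)" for x t
    using that by (intro subst_cong) auto
  from Node.prems consider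
    "i \<in> set (leaves a)" "i \<notin> set (leaves b)" "i \<notin> set (leaves c)"
    | "i \<in> set (leaves b)" "i \<notin> set (leaves a)" "i \<notin> set (leaves c)"
    | "i \<in> set (leaves c)" "i \<notin> set (leaves a)" "i \<notin> set (leaves b)" by auto
  then show ?case
  proof cases
    case 1
    then obtain F where "context_map F" "\<forall>x. subst (\<lambda>j. if j = i then x else \<tau> j) a = F x"
      using Node by auto
    then show ?thesis using 1 outside
      by (intro exI[of _ "\<lambda>x. Node g (F x) (subst \<tau> b) (subst \<tau> c)"]) (auto intro: context_map.left)
  next
    case 2
    then obtain F where "context_map F" "\<forall>x. subst (\<lambda>j. if j = i then x else \<tau> j) b = F x"
      using Node by auto
    then show ?thesis using 2 outside
      by (intro exI[of _ "\<lambda>x. Node g (subst \<tau> a) (F x) (subst \<tau> c)"]) (auto intro: context_map.middle)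
  next
    case 3
    then obtain F where "context_map F" "\<forall>x. subst (\<lambda>j. if j = i then x else \<tau> j) c = F x"
      using Node by auto
    then show ?thesis using 3 outside
      by (intro exI[of _ "\<lambda>x. Node g (subst \<tau> a) (subst \<tau> b) (F x)"]) (auto intro: context_map.right)
  qed
qed

lemma comtrans_functional_subst:
  assumes "comtrans_functional \<phi>"
  shows "comtrans_functional (\<lambda>t. \<phi> (subst \<tau> t))"
  unfolding comtrans_functional_def
proof (intro allI impI)
  fix F :: "comtrans_op tree \<Rightarrow> comtrans_op tree" and a b c
  assume "context_map F"
  then obtain G where "context_map G" "\<forall>x. subst \<tau> (F x) = G (subst \<tau> x)"
    using subst_context by blast
  then show "satisfies_relations (\<lambda>x. \<phi> (subst \<tau> (F x))) a b c"
    using assms by (simp add: comtrans_functional_def satisfies_relations_def)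
qed

lemma comtrans_functional_context:
  assumes "comtrans_functional \<phi>" "context_map F"
  shows "comtrans_functional (\<lambda>t. \<phi> (F t))"
  using assms context_map_compose[OF assms(2)] by (auto simp: comtrans_functional_def)

lemma comtrans_functional_shuffle_graft_inner:
  assumes "comtrans_functional \<phi>" "distinct (leaves s)" "i \<in> set (leaves s)"
  shows "comtrans_functional (\<lambda>t. \<phi> (shuffle_graft i v u s t))"
proof -
  obtain F where F: "context_map F"
    "\<forall>x. subst (\<lambda>j. if j = i then x else Leaf (v j)) s = F x"
    using subst_single_hole[OF assms(2,3), of "\<lambda>j. Leaf (v j)"] by blast
  have "comtrans_functional (\<lambda>t. \<phi> (F (relabel u t)))"
    unfolding relabel_def
    by (rule comtrans_functional_subst[OF comtrans_functional_context[OF assms(1) F(1)]])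
  then show ?thesis using F(2) by (simp add: shuffle_graft_def)
qed

lemma comtrans_functional_shuffle_graft_outer:
  "comtrans_functional \<phi> \<Longrightarrow> comtrans_functional (\<lambda>s. \<phi> (shuffle_graft i v u s t))"
  unfolding shuffle_graft_def by (rule comtrans_functional_subst)

text \<open>
  The common kernel of all such functions. It is described by its annihilator because closure under
  composition is then dual to the stability of the functions under substitution and insertion
  into a context.
\<close>

definition functional_kernel :: "nat \<Rightarrow> (comtrans_op tree \<Rightarrow>\<^sub>0 'k::field) set" where
  "functional_kernel n = {f \<in> sym_operad n. \<forall>\<phi>. comtrans_functional \<phi> \<longrightarrow> pair \<phi> f = 0}"

lemma sym_ideal_functional_kernel:
  "sym_ideal (functional_kernel :: nat \<Rightarrow> (comtrans_op tree \<Rightarrow>\<^sub>0 'k::field) set)"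
  unfolding sym_ideal_def
proof (intro conjI allI impI)
  fix n
  let ?K = "functional_kernel :: nat \<Rightarrow> (comtrans_op tree \<Rightarrow>\<^sub>0 'k::field) set"
  show "?K n \<subseteq> sym_operad n" by (auto simp: functional_kernel_def)
  show "is_subspace (?K n)"
    using is_subspace_sym_operad[of n] by (auto simp: is_subspace_def functional_kernel_def)
next
  fix n \<sigma> and f :: "comtrans_op tree \<Rightarrow>\<^sub>0 'k"
  assume *: "\<sigma> permutes {1..n} \<and> f \<in> functional_kernel n"
  then have "linear_ext (relabel \<sigma>) f \<in> sym_operad n"
    by (intro sym_operad_relabel) (simp_all add: functional_kernel_def)
  then show "linear_ext (relabel \<sigma>) f \<in> functional_kernel n"
    using * comtrans_functional_subst by (auto simp: functional_kernel_def relabel_def)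
next
  fix n m i and f g :: "comtrans_op tree \<Rightarrow>\<^sub>0 'k"
  assume *: "i \<in> {1..n} \<and> f \<in> sym_operad n \<and> g \<in> sym_operad m \<and>
    (f \<in> functional_kernel n \<or> g \<in> functional_kernel m)"
  let ?G = "shuffle_graft i (block_outer i m) (block_inner i) :: comtrans_op tree \<Rightarrow> _"
  have "pair \<phi> (bilinear_ext ?G f g) = 0" if \<phi>: "comtrans_functional \<phi>" for \<phi> :: "_ \<Rightarrow> 'k"
  proof (cases "f \<in> functional_kernel n")
    case True
    then have "pair (\<lambda>s. \<phi> (?G s t)) f = 0" for t
      using comtrans_functional_shuffle_graft_outer[OF \<phi>] by (simp add: functional_kernel_def)
    then show ?thesis
      unfolding pair_bilinear_ext by (subst pair_swap) (simp add: pair_def[of _ g])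
  next
    case False
    then have g: "g \<in> functional_kernel m" using * by blast
    have "pair (\<lambda>t. \<phi> (?G s t)) g = 0" if "s \<in> Poly_Mapping.keys f" for s
    proof -
      have "s \<in> sym_monomials n" using that * by (auto simp: sym_operad_def)
      then have "comtrans_functional (\<lambda>t. \<phi> (?G s t))"
        using * \<phi> by (intro comtrans_functional_shuffle_graft_inner) (auto simp: sym_monomials_def)
      then show ?thesis using g by (simp add: functional_kernel_def)
    qed
    then show ?thesis unfolding pair_bilinear_ext by (simp add: pair_def[of _ f])
  qed
  then show "bilinear_ext (graft i) f g \<in> functional_kernel (n + m - 1)"
    using * sym_operad_bilinear_graft[of i n f g m] bilinear_graft_eq[of g m i f]
    by (simp add: functional_kernel_def)
qed

lemma ternary_sym_monomial:
  assumes "{i, j, l} = {1, 2, 3}" "distinct [i, j, l]"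
  shows "Node g (Leaf i) (Leaf j) (Leaf l) \<in> sym_monomials 3"
proof -
  have "{1, 2, 3} = {1..3::nat}" by auto
  with assms(1) have "set [i, j, l] = {1..3}" by (simp only: list.set)
  then show ?thesis using assms(2) by (simp add: sym_monomials_def)
qed

lemma comtrans_relations_in_functional_kernel: 
  "comtrans_relations m \<subseteq> (functional_kernel m :: (comtrans_op tree \<Rightarrow>\<^sub>0 'k::field) set)"
proof (cases "m = 3")
  case True
  have "f \<in> functional_kernel 3" if f: "f \<in> comtrans_relations 3" for f :: "comtrans_op tree \<Rightarrow>\<^sub>0 'k"
  proof -
    have V: "is_subspace (sym_operad 3 :: (comtrans_op tree \<Rightarrow>\<^sub>0 'k) set)"
      by (rule is_subspace_sym_operad)
    have gens: "(commutator i j l :: _ \<Rightarrow>\<^sub>0 'k) \<in> sym_operad 3" "(translator i j l :: _ \<Rightarrow>\<^sub>0 'k) \<in> sym_operad 3"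
      if "{i, j, l} = {1, 2, 3}" "distinct [i, j, l]" for i j l
      using ternary_sym_monomial[OF that] by (simp_all add: sym_operad_def commutator_def translator_def)
    have sym: "f \<in> sym_operad 3"
      using f V by (auto simp: comtrans_relations_def intro!: is_subspace_add is_subspace_diff gens)
    have "pair \<phi> f = 0" if "comtrans_functional \<phi>" for \<phi> :: "comtrans_op tree \<Rightarrow> 'k"
    proof -
      have "satisfies_relations \<phi> (Leaf 1) (Leaf 2) (Leaf 3)"
        using that context_map.hole unfolding comtrans_functional_def by blast
      then show ?thesis using f
        by (auto simp: comtrans_relations_def commutator_def translator_def satisfies_relations_def)
    qed
    with sym show ?thesis by (simp add: functional_kernel_def)
  qed
  with True show ?thesis by blast
qed (simp add: comtrans_relations_def)

lemma sym_ideal_comtrans_ideal: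
  "sym_ideal (comtrans_ideal :: nat \<Rightarrow> (comtrans_op tree \<Rightarrow>\<^sub>0 'k::field) set)"
  unfolding comtrans_ideal_def
  by (rule sym_ideal_ideal_generated[OF sym_ideal_functional_kernel comtrans_relations_in_functional_kernel])

lemma pair_comtrans_ideal:
  assumes "f \<in> comtrans_ideal n" "comtrans_functional \<phi>"
  shows "pair \<phi> f = 0"
proof -
  have "f \<in> functional_kernel n"
    using assms(1) sym_ideal_functional_kernel comtrans_relations_in_functional_kernel
    unfolding comtrans_ideal_def by (rule ideal_generated_in_ideal)
  then show ?thesis using assms(2) by (simp add: functional_kernel_def)
qed

section \<open>Coefficients of normal forms\<close>

text \<open>
  The coefficient of the generator \<open>h\<close> in the normal form of the generator \<open>g\<close>: each of the
  seven leading generators is replaced by the remaining terms of its basis element with opposite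
  sign, and the other five generators are their own normal forms.
\<close>

fun normal_coeff :: "comtrans_gen \<Rightarrow> comtrans_gen \<Rightarrow> 'k::field" where
  "normal_coeff (Translator, XYZ) h =
     - of_bool (h = (Translator, ZYX)) - of_bool (h = (Commutator, YXZ)) + of_bool (h = (Commutator, ZYX))"
| "normal_coeff (Translator, XZY) h =
     of_bool (h = (Translator, ZXY)) - of_bool (h = (Translator, ZYX))
     - of_bool (h = (Commutator, YXZ)) - of_bool (h = (Commutator, ZXY))"
| "normal_coeff (Translator, YXZ) h =
     - of_bool (h = (Translator, ZXY)) + of_bool (h = (Commutator, YXZ)) + of_bool (h = (Commutator, ZXY))"
| "normal_coeff (Translator, YZX) h =
     - of_bool (h = (Translator, ZXY)) + of_bool (h = (Translator, ZYX))
     + of_bool (h = (Commutator, YXZ)) - of_bool (h = (Commutator, ZYX))"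
| "normal_coeff (Commutator, XYZ) h = - of_bool (h = (Commutator, YXZ))"
| "normal_coeff (Commutator, XZY) h = - of_bool (h = (Commutator, ZXY))"
| "normal_coeff (Commutator, YZX) h = - of_bool (h = (Commutator, ZYX))"
| "normal_coeff g h = of_bool (h = g)"

text \<open>
  The coefficient of the shuffle monomial \<open>m\<close> in the normal form of a symmetric monomial, which is
  obtained by sorting the subtrees of each vertex by their minimal leaves and rewriting all vertices
  simultaneously. As every relation is linear in the generators, the coefficient is a product
  over the vertices. The value 0 when two minimal leaves agree makes the relations
  hold also for trees with repeated labels.
\<close>

fun coeff :: "comtrans_gen tree \<Rightarrow> comtrans_op tree \<Rightarrow> 'k::field" where
  "coeff (Leaf i) (Leaf j) = of_bool (i = j)"
| "coeff (Node h a b c) (Node g x y z) =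
     (if min_leaf x < min_leaf y \<and> min_leaf y < min_leaf z then normal_coeff (g, XYZ) h * coeff a x * coeff b y * coeff c z
      else if min_leaf x < min_leaf z \<and> min_leaf z < min_leaf y then normal_coeff (g, XZY) h * coeff a x * coeff b z * coeff c y
      else if min_leaf y < min_leaf x \<and> min_leaf x < min_leaf z then normal_coeff (g, YXZ) h * coeff a y * coeff b x * coeff c z
      else if min_leaf z < min_leaf x \<and> min_leaf x < min_leaf y then normal_coeff (g, YZX) h * coeff a z * coeff b x * coeff c y
      else if min_leaf y < min_leaf z \<and> min_leaf z < min_leaf x then normal_coeff (g, ZXY) h * coeff a y * coeff b z * coeff c x
      else if min_leaf z < min_leaf y \<and> min_leaf y < min_leaf x then normal_coeff (g, ZYX) h * coeff a z * coeff b y * coeff c x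
      else 0)"
| "coeff _ _ = 0"

declare normal_coeff.simps [simp del]

text \<open>
  The seven rewriting rules, stated for the rows of the coefficient matrix; in this form the
  relations can be verified without distinguishing the column \<open>h\<close>.
\<close>

lemma normal_coeff_leading:
  "normal_coeff (Translator, XYZ) h = - normal_coeff (Translator, ZYX) h
     - normal_coeff (Commutator, YXZ) h + normal_coeff (Commutator, ZYX) h"
  "normal_coeff (Translator, XZY) h = normal_coeff (Translator, ZXY) h - normal_coeff (Translator, ZYX) h
     - normal_coeff (Commutator, YXZ) h - normal_coeff (Commutator, ZXY) h"
  "normal_coeff (Translator, YXZ) h = - normal_coeff (Translator, ZXY) h
     + normal_coeff (Commutator, YXZ) h + normal_coeff (Commutator, ZXY) h"
  "normal_coeff (Translator, YZX) h = - normal_coeff (Translator, ZXY) h + normal_coeff (Translator, ZYX) h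
     + normal_coeff (Commutator, YXZ) h - normal_coeff (Commutator, ZYX) h"
  "normal_coeff (Commutator, XYZ) h = - normal_coeff (Commutator, YXZ) h"
  "normal_coeff (Commutator, XZY) h = - normal_coeff (Commutator, ZXY) h"
  "normal_coeff (Commutator, YZX) h = - normal_coeff (Commutator, ZYX) h"
  by (simp_all only: normal_coeff.simps)

lemma coeff_Node:
  "min_leaf x < min_leaf y \<Longrightarrow> min_leaf y < min_leaf z \<Longrightarrow>
     coeff (Node h a b c) (Node g x y z) = normal_coeff (g, XYZ) h * coeff a x * coeff b y * coeff c z"
  "min_leaf x < min_leaf z \<Longrightarrow> min_leaf z < min_leaf y \<Longrightarrow>
     coeff (Node h a b c) (Node g x y z) = normal_coeff (g, XZY) h * coeff a x * coeff b z * coeff c y"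
  "min_leaf y < min_leaf x \<Longrightarrow> min_leaf x < min_leaf z \<Longrightarrow>
     coeff (Node h a b c) (Node g x y z) = normal_coeff (g, YXZ) h * coeff a y * coeff b x * coeff c z"
  "min_leaf z < min_leaf x \<Longrightarrow> min_leaf x < min_leaf y \<Longrightarrow>
     coeff (Node h a b c) (Node g x y z) = normal_coeff (g, YZX) h * coeff a z * coeff b x * coeff c y"
  "min_leaf y < min_leaf z \<Longrightarrow> min_leaf z < min_leaf x \<Longrightarrow>
     coeff (Node h a b c) (Node g x y z) = normal_coeff (g, ZXY) h * coeff a y * coeff b z * coeff c x"
  "min_leaf z < min_leaf y \<Longrightarrow> min_leaf y < min_leaf x \<Longrightarrow>
     coeff (Node h a b c) (Node g x y z) = normal_coeff (g, ZYX) h * coeff a z * coeff b y * coeff c x"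
  "min_leaf x = min_leaf y \<Longrightarrow> coeff (Node h a b c) (Node g x y z) = 0"
  "min_leaf x = min_leaf z \<Longrightarrow> coeff (Node h a b c) (Node g x y z) = 0"
  "min_leaf y = min_leaf z \<Longrightarrow> coeff (Node h a b c) (Node g x y z) = 0"
  by auto

declare coeff.simps(2) [simp del]

lemma order_cases:
  fixes p q r :: nat
  obtains "p < q" "q < r" | "p < r" "r < q" | "q < p" "p < r" | "r < p" "p < q"
    | "q < r" "r < p" | "r < q" "q < p" | "p = q" | "p = r" | "q = r"
  by (metis nat_neq_iff)

lemma satisfies_relations_iff:
  fixes \<phi> :: "comtrans_op tree \<Rightarrow> 'a::field"
  shows
  "satisfies_relations \<phi> a b c \<longleftrightarrow>
     \<phi> (C b a c) = - \<phi> (C a b c) \<and>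
     \<phi> (T c a b) = - \<phi> (T a b c) - \<phi> (T b c a) \<and>
     \<phi> (C c b a) = \<phi> (T a b c) + \<phi> (T c b a) - \<phi> (C a b c)"
proof -
  have "x + y + z = 0 \<longleftrightarrow> z = - x - y" for x y z :: 'a
    using add_eq_0_iff[of "x + y" z] by simp
  moreover have "x + y - z - w = 0 \<longleftrightarrow> y = z + w - x" for x y z w :: 'a
    using eq_iff_diff_eq_0[of y "z + w - x"] by (simp add: diff_diff_eq add.commute algebra_simps)
  ultimately show ?thesis by (simp add: satisfies_relations_def add_eq_0_iff)
qed

text \<open>
  The heart of the matter is that the rewriting rules imply all relations, also after the three
  arguments are permuted. For each of the six orders of the minimal leaves this is a
  linear identity between rows of the coefficient matrix.
\<close>

lemma satisfies_relations_coeff: "satisfies_relations (coeff m) a b c"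
proof (cases m)
  case (Node h m1 m2 m3)
  show ?thesis
    by (rule order_cases[of "min_leaf a" "min_leaf b" "min_leaf c"])
      (simp_all add: Node satisfies_relations_def coeff_Node normal_coeff_leading algebra_simps)
qed (simp add: satisfies_relations_def)

lemma leaves_context_cong:
  "context_map F \<Longrightarrow> set (leaves x) = set (leaves y) \<Longrightarrow> set (leaves (F x)) = set (leaves (F y))"
  by (induction rule: context_map.induct) auto

text \<open>
  All monomials of a relation have the same leaves. Placed below a vertex, they are therefore sorted
  in the same way there, so that vertex contributes one common factor.
\<close>

lemma satisfies_relations_coeff_context:
  assumes "context_map F"
  shows "satisfies_relations (\<lambda>x. coeff m (F x)) a b c"
  using assms
proof (induction arbitrary: m)
  case hole
  show ?case by (rule satisfies_relations_coeff)
next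
  case (left F g y z)
  show ?case
  proof (cases m)
    case (Node h m1 m2 m3)
    define k where "k = min_leaf (F (C a b c))"
    have k: "min_leaf (F x) = k" if "set (leaves x) = set (leaves (C a b c))" for x
      using leaves_context_cong[OF left.hyps that] by (simp add: k_def min_leaf_def)
    have [simp]: "min_leaf (F (Node f a b c)) = k" "min_leaf (F (Node f b a c)) = k"
      "min_leaf (F (Node f b c a)) = k" "min_leaf (F (Node f c a b)) = k"
      "min_leaf (F (Node f c b a)) = k" for f
      by (auto intro: k)
    note IH = left.IH[unfolded satisfies_relations_iff]
    show ?thesis
      by (rule order_cases[of k "min_leaf y" "min_leaf z"])
        (simp_all add: Node IH satisfies_relations_def coeff_Node algebra_simps)
  qed (simp add: satisfies_relations_def)
next
  case (middle F g y z)
  show ?case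
  proof (cases m)
    case (Node h m1 m2 m3)
    define k where "k = min_leaf (F (C a b c))"
    have k: "min_leaf (F x) = k" if "set (leaves x) = set (leaves (C a b c))" for x
      using leaves_context_cong[OF middle.hyps that] by (simp add: k_def min_leaf_def)
    have [simp]: "min_leaf (F (Node f a b c)) = k" "min_leaf (F (Node f b a c)) = k"
      "min_leaf (F (Node f b c a)) = k" "min_leaf (F (Node f c a b)) = k"
      "min_leaf (F (Node f c b a)) = k" for f
      by (auto intro: k)
    note IH = middle.IH[unfolded satisfies_relations_iff]
    show ?thesis
      by (rule order_cases[of "min_leaf y" k "min_leaf z"])
        (simp_all add: Node IH satisfies_relations_def coeff_Node algebra_simps)
  qed (simp add: satisfies_relations_def)
next
  case (right F g y z)
  show ?case
  proof (cases m)
    case (Node h m1 m2 m3)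
    define k where "k = min_leaf (F (C a b c))"
    have k: "min_leaf (F x) = k" if "set (leaves x) = set (leaves (C a b c))" for x
      using leaves_context_cong[OF right.hyps that] by (simp add: k_def min_leaf_def)
    have [simp]: "min_leaf (F (Node f a b c)) = k" "min_leaf (F (Node f b a c)) = k"
      "min_leaf (F (Node f b c a)) = k" "min_leaf (F (Node f c a b)) = k"
      "min_leaf (F (Node f c b a)) = k" for f
      by (auto intro: k)
    note IH = right.IH[unfolded satisfies_relations_iff]
    show ?thesis
      by (rule order_cases[of "min_leaf y" "min_leaf z" k])
        (simp_all add: Node IH satisfies_relations_def coeff_Node algebra_simps)
  qed (simp add: satisfies_relations_def)
qed

lemma comtrans_functional_coeff: "comtrans_functional (coeff m)"
  using satisfies_relations_coeff_context by (auto simp: comtrans_functional_def)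

lemma coeff_realize_Node:
  assumes "is_shuffle (Node g x y z)"
  shows "coeff (Node h a b c) (realize (Node g x y z)) =
    normal_coeff g h * coeff a (realize x) * coeff b (realize y) * coeff c (realize z)"
  using assms by (cases g; cases "snd g") (auto simp: coeff_Node)

section \<open>Leading monomials\<close>

text \<open>
  Position in the list of generators, so that a greater rank means a smaller generator.
\<close>

fun rank :: "comtrans_gen \<Rightarrow> nat" where
  "rank (Translator, XYZ) = 0"
| "rank (Translator, XZY) = 1"
| "rank (Translator, YXZ) = 2"
| "rank (Translator, YZX) = 3"
| "rank (Translator, ZXY) = 4"
| "rank (Translator, ZYX) = 5"
| "rank (Commutator, XYZ) = 6"
| "rank (Commutator, XZY) = 7"
| "rank (Commutator, YXZ) = 8"
| "rank (Commutator, YZX) = 9"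
| "rank (Commutator, ZXY) = 10"
| "rank (Commutator, ZYX) = 11"

lemma generators_rank: "rank g < length generators \<and> generators ! rank g = g"
proof -
  obtain k p where "g = (k, p)" by (cases g)
  then show ?thesis by (cases k; cases p) (simp_all add: generators_def)
qed

lemma rank_generators: "i < length generators \<Longrightarrow> rank (generators ! i) = i"
proof -
  have "distinct generators" by (simp add: generators_def)
  then show "i < length generators \<Longrightarrow> rank (generators ! i) = i"
    using generators_rank nth_eq_iff_index_eq by blast
qed

lemma generator_less_iff: "(g, h) \<in> generator_less \<longleftrightarrow> rank h < rank g"
proof
  assume "rank h < rank g"
  then show "(g, h) \<in> generator_less"
    unfolding generator_less_def using generators_rank[of g] generators_rank[of h]
    by (intro CollectI exI[of _ "rank g"] exI[of _ "rank h"]) auto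
qed (auto simp: generator_less_def rank_generators)

lemma trans_generator_less: "trans generator_less"
  by (auto simp: trans_def generator_less_iff)

lemma irrefl_generator_less: "irrefl generator_less"
  by (auto simp: irrefl_def generator_less_iff)

lemma total_generator_less: "total generator_less"
  unfolding total_on_def generator_less_iff by (metis generators_rank nat_neq_iff)

lemma normal_coeff_nonzero:
  "normal_coeff g h \<noteq> (0::'k::field) \<Longrightarrow> h = g \<or> (h, g) \<in> generator_less"
proof -
  assume *: "normal_coeff g h \<noteq> (0::'k::field)"
  obtain k p where "g = (k, p)" by (cases g)
  with * show ?thesis
    by (cases k; cases p) (auto simp: normal_coeff.simps generator_less_iff of_bool_def split: if_splits)
qed

text \<open>
  Rewriting keeps the shape and the leaves of a tree and makes its labels smaller or leaves
  them unchanged, so every path becomes smaller or stays the same.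
\<close>

lemma coeff_nonzero_dominated:
  assumes "coeff m (realize s) \<noteq> (0::'k::field)" "is_shuffle s"
  shows "leaves m = leaves s \<and>
    (\<forall>i. list_all2 (\<lambda>h g. h = g \<or> (h, g) \<in> generator_less) (path i m) (path i s))"
  using assms
proof (induction s arbitrary: m)
  case (Leaf i)
  then show ?case by (cases m) (auto split: if_splits)
next
  case (Node g x y z)
  have "m \<noteq> Leaf i" for i using Node.prems(1) by (cases "snd g") auto
  then obtain h a b c where m: "m = Node h a b c" by (cases m) auto
  have *: "normal_coeff g h * coeff a (realize x) * coeff b (realize y) * coeff c (realize z) \<noteq> (0::'k)"
    using Node.prems(1) unfolding m coeff_realize_Node[OF Node.prems(2)] .
  have "h = g \<or> (h, g) \<in> generator_less"
    using * by (intro normal_coeff_nonzero[where 'k = 'k]) auto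
  moreover have "leaves a = leaves x \<and>
    (\<forall>i. list_all2 (\<lambda>h g. h = g \<or> (h, g) \<in> generator_less) (path i a) (path i x))"
    using * Node.prems by (intro Node.IH) auto
  moreover have "leaves b = leaves y \<and>
    (\<forall>i. list_all2 (\<lambda>h g. h = g \<or> (h, g) \<in> generator_less) (path i b) (path i y))"
    using * Node.prems by (intro Node.IH) auto
  moreover have "leaves c = leaves z \<and>
    (\<forall>i. list_all2 (\<lambda>h g. h = g \<or> (h, g) \<in> generator_less) (path i c) (path i z))"
    using * Node.prems by (intro Node.IH) auto
  ultimately show ?case by (simp add: m)
qed

lemma trans_comtrans_less: "trans comtrans_less"
  unfolding comtrans_less_def by (intro trans_path_deglex trans_generator_less)

lemma irrefl_comtrans_less: "irrefl comtrans_less"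
  unfolding comtrans_less_def irrefl_def using path_deglex_irrefl[OF irrefl_generator_less] by blast

text \<open>
  Domination of all paths makes the path sequence of \<open>m\<close> smaller than or equal to that of \<open>s\<close>, and
  the two leaf sequences agree, so the tie-break of the order cannot place \<open>s\<close> below \<open>m\<close>.
\<close>

lemma coeff_eq_0_if_less:
  assumes "(s, m) \<in> comtrans_less" "is_shuffle s"
  shows "coeff m (realize s) = (0::'k::field)"
proof (rule ccontr)
  assume "coeff m (realize s) \<noteq> (0::'k)"
  note dom = coeff_nonzero_dominated[OF this assms(2)]
  have tr: "trans (lenlex (lenlex generator_less))"
    by (intro lenlex_transI trans_generator_less)
  have ir: "(xs, xs) \<notin> lenlex (lenlex generator_less)" for xs
    using irrefl_generator_less by (intro lenlex_irreflexive) (auto simp: irrefl_def)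
  have "list_all2 (\<lambda>v w. v = w \<or> (v, w) \<in> lenlex generator_less) (path_sequence m) (path_sequence s)"
    using dom list_all2_imp_lenlex[of generator_less]
    by (simp add: path_sequence_def list_all2_map1 list_all2_map2 list_all2_same del: upt_Suc)
  then have "path_sequence m = path_sequence s \<or>
    (path_sequence m, path_sequence s) \<in> lenlex (lenlex generator_less)"
    by (rule list_all2_imp_lenlex)
  moreover have "(leaves m, leaves s) \<notin> lex less_than"
    using dom irrefl_lex[of less_than] by (auto simp: irrefl_def)
  ultimately show False
    using assms(1) ir tr unfolding comtrans_less_def path_deglex_def by (auto dest: transD)
qed

definition leading_generators :: "comtrans_gen list" where
  "leading_generators = 
     [(Translator, XYZ), (Translator, XZY), (Translator, YXZ), (Translator, YZX),
      (Commutator, XYZ), (Commutator, XZY), (Commutator, YZX)]"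

lemma normal_coeff_normal:
  "g \<notin> set leading_generators \<Longrightarrow> normal_coeff g h = of_bool (h = g)"
proof -
  assume *: "g \<notin> set leading_generators"
  obtain k p where "g = (k, p)" by (cases g)
  with * show ?thesis by (cases k; cases p) (auto simp: normal_coeff.simps leading_generators_def)
qed

lemma coeff_self:
  assumes "is_shuffle m" "set_tree m \<inter> set leading_generators = {}"
  shows "coeff m (realize m) = (1::'k::field)"
  using assms
proof (induction m)
  case (Node g a b c)
  have "coeff a (realize a) = (1::'k)" "coeff b (realize b) = (1::'k)" "coeff c (realize c) = (1::'k)"
    using Node by auto
  moreover have "g \<notin> set leading_generators" using Node.prems by auto
  ultimately show ?case
    using Node.prems(1) by (simp only: coeff_realize_Node) (simp add: normal_coeff_normal)
qed simp

lemma label_in_subtree: "g \<in> set_tree t \<Longrightarrow> \<exists>a b c. Node g a b c \<in> subtrees t"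
  by (induction t) (simp, simp, blast)

lemma corolla_divides:
  assumes "g \<in> set_tree m" "is_shuffle m"
  shows "divides (corolla g) m"
proof -
  obtain a b c where *: "Node g a b c \<in> subtrees m" using label_in_subtree[OF assms(1)] by blast
  have "is_shuffle t" if "t \<in> subtrees m" for t
    using that assms(2) by (induction m) auto
  then have "is_shuffle (Node g a b c)" using * by blast
  then show ?thesis
    using * unfolding divides_def corolla_def
    by (intro exI[of _ "\<lambda>i. if i = 1 then a else if i = 2 then b else c"])
      (auto simp: strict_mono_on_def)
qed

lemma leading_monomial_shuffle:
  fixes f :: "comtrans_gen tree \<Rightarrow>\<^sub>0 'k::field"
  assumes "f \<in> shuffle_operad n" "f \<noteq> 0"
  defines "m \<equiv> leading_monomial comtrans_less f"
  shows "m \<in> Poly_Mapping.keys f"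
    "\<And>s. s \<in> Poly_Mapping.keys f \<Longrightarrow> s \<noteq> m \<Longrightarrow> (s, m) \<in> comtrans_less"
proof -
  have keys: "Poly_Mapping.keys f \<subseteq> sym_monomials n"
    using assms by (auto simp: shuffle_operad_def shuffle_monomials_def)
  have "total_on (Poly_Mapping.keys f) comtrans_less"
    unfolding total_on_def comtrans_less_def
    using path_deglex_total[OF total_generator_less] keys by blast
  then obtain t where t: "t \<in> Poly_Mapping.keys f"
    "\<forall>s\<in>Poly_Mapping.keys f. s \<noteq> t \<longrightarrow> (s, t) \<in> comtrans_less"
    using finite_has_greatest[of "Poly_Mapping.keys f" comtrans_less] trans_comtrans_less assms(2)
    by auto
  then have "m = t"
    unfolding m_def using trans_comtrans_less irrefl_comtrans_less by (intro leading_monomial_eqI) auto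
  with t show "m \<in> Poly_Mapping.keys f"
    "\<And>s. s \<in> Poly_Mapping.keys f \<Longrightarrow> s \<noteq> m \<Longrightarrow> (s, m) \<in> comtrans_less" by auto
qed

text \<open>
  If \<open>m = leading_monomial comtrans_less f\<close> contained no leading generator, it would be its own normal form and would
  occur in the normal form of no other monomial of \<open>f\<close>, as these are smaller. The
  coefficient of \<open>m\<close> in the normal form of \<open>f\<close> would be its coefficient in \<open>f\<close>. But the former is 0,
  since the coefficient functionals vanish on the ideal.
\<close>

lemma leading_monomial_not_normal:
  fixes f :: "comtrans_gen tree \<Rightarrow>\<^sub>0 'k::field"
  assumes "f \<in> forget_ideal comtrans_ideal n" "f \<noteq> 0"
  shows "\<exists>g\<in>set leading_generators. divides (corolla g) (leading_monomial comtrans_less f)"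
proof (rule ccontr)
  assume contra: "\<not> ?thesis"
  define m where "m = leading_monomial comtrans_less f"
  have f: "f \<in> shuffle_operad n" "linear_ext realize f \<in> comtrans_ideal n"
    using assms(1) by (auto simp: forget_ideal_def)
  note lm = leading_monomial_shuffle[OF f(1) assms(2), folded m_def]
  have shuffle: "is_shuffle s" if "s \<in> Poly_Mapping.keys f" for s
    using that f(1) by (auto simp: shuffle_operad_def shuffle_monomials_def)
  have "set_tree m \<inter> set leading_generators = {}"
    using corolla_divides[OF _ shuffle[OF lm(1)]] contra unfolding m_def by blast
  then have self: "coeff m (realize m) = (1::'k)"
    by (rule coeff_self[OF shuffle[OF lm(1)]])
  have "pair (\<lambda>s. coeff m (realize s)) f = 0"
    using pair_comtrans_ideal[OF f(2) comtrans_functional_coeff[of m]] by simp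
  moreover have "pair (\<lambda>s. coeff m (realize s)) f = pair (\<lambda>s. of_bool (s = m)) f"
    using lm(2) shuffle self by (intro pair_cong) (auto intro: coeff_eq_0_if_less)
  ultimately have "Poly_Mapping.lookup f m = 0" by (simp add: lookup_eq_pair)
  then show False using lm(1) by (simp add: in_keys_iff)
qed

section \<open>The seven elements\<close>

text \<open>
  The orbits of the defining relations under the symmetric group.
\<close>

lemma comtrans_ideal_relations:
  assumes "{i, j, l} = {1, 2, 3}" "distinct [i, j, l]"
  shows "commutator i j l + commutator j i l \<in> (comtrans_ideal 3 :: (_ \<Rightarrow>\<^sub>0 'k::field) set)"
    "translator i j l + translator j l i + translator l i j \<in> (comtrans_ideal 3 :: (_ \<Rightarrow>\<^sub>0 'k) set)"
    "commutator i j l + commutator l j i - translator i j l - translator l j i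
       \<in> (comtrans_ideal 3 :: (_ \<Rightarrow>\<^sub>0 'k) set)"
proof -
  define \<sigma> :: "nat \<Rightarrow> nat"
    where "\<sigma> x = (if x = 1 then i else if x = 2 then j else if x = 3 then l else x)" for x
  have \<sigma>123: "\<sigma> 1 = i" "\<sigma> 2 = j" "\<sigma> 3 = l" by (simp_all add: \<sigma>_def)
  have set3: "{1..3} = {1, 2, 3::nat}" by auto
  have "\<sigma> ` {1..3} = {1..3}" unfolding set3 by (simp only: image_insert image_empty \<sigma>123 assms(1))
  then have "bij_betw \<sigma> {1..3} {1..3}"
    by (simp add: bij_betw_def eq_card_imp_inj_on)
  then have \<sigma>: "\<sigma> permutes {1..3}"
    by (rule bij_imp_permutes) (auto simp: \<sigma>_def)
  have closed: "linear_ext (relabel \<sigma>) f \<in> comtrans_ideal 3"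
    if "f \<in> comtrans_relations 3" for f :: "_ \<Rightarrow>\<^sub>0 'k"
    using sym_ideal_comtrans_ideal[where 'k = 'k] \<sigma> that
    by (simp add: sym_ideal_def comtrans_ideal_def relations_in_ideal_generated)
  have comm: "linear_ext (relabel \<sigma>) (commutator a b c) = (commutator (\<sigma> a) (\<sigma> b) (\<sigma> c) :: _ \<Rightarrow>\<^sub>0 'k)"
    and tran: "linear_ext (relabel \<sigma>) (translator a b c) = (translator (\<sigma> a) (\<sigma> b) (\<sigma> c) :: _ \<Rightarrow>\<^sub>0 'k)"
    for a b c
    by (simp_all add: commutator_def translator_def linear_ext_single relabel_def)
  note rules = linear_ext_add linear_ext_diff comm tran \<sigma>123
  have "linear_ext (relabel \<sigma>) (commutator 1 2 3 + commutator 2 1 3 :: _ \<Rightarrow>\<^sub>0 'k) \<in> comtrans_ideal 3"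
    by (rule closed) (simp add: comtrans_relations_def)
  then show "commutator i j l + commutator j i l \<in> (comtrans_ideal 3 :: (_ \<Rightarrow>\<^sub>0 'k) set)"
    by (simp only: rules)
  have "linear_ext (relabel \<sigma>) (translator 1 2 3 + translator 2 3 1 + translator 3 1 2 :: _ \<Rightarrow>\<^sub>0 'k)
      \<in> comtrans_ideal 3"
    by (rule closed) (simp add: comtrans_relations_def)
  then show "translator i j l + translator j l i + translator l i j \<in> (comtrans_ideal 3 :: (_ \<Rightarrow>\<^sub>0 'k) set)"
    by (simp only: rules)
  have "linear_ext (relabel \<sigma>) (commutator 1 2 3 + commutator 3 2 1 - translator 1 2 3 - translator 3 2 1
      :: _ \<Rightarrow>\<^sub>0 'k) \<in> comtrans_ideal 3"
    by (rule closed) (simp add: comtrans_relations_def)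
  then show "commutator i j l + commutator l j i - translator i j l - translator l j i
       \<in> (comtrans_ideal 3 :: (_ \<Rightarrow>\<^sub>0 'k) set)"
    by (simp only: rules)
qed

lemma linear_ext_realize_generators:
  "linear_ext realize (com XYZ) = (commutator 1 2 3 :: _ \<Rightarrow>\<^sub>0 'k::field)"
  "linear_ext realize (com XZY) = (commutator 1 3 2 :: _ \<Rightarrow>\<^sub>0 'k)"
  "linear_ext realize (com YXZ) = (commutator 2 1 3 :: _ \<Rightarrow>\<^sub>0 'k)"
  "linear_ext realize (com YZX) = (commutator 2 3 1 :: _ \<Rightarrow>\<^sub>0 'k)"
  "linear_ext realize (com ZXY) = (commutator 3 1 2 :: _ \<Rightarrow>\<^sub>0 'k)"
  "linear_ext realize (com ZYX) = (commutator 3 2 1 :: _ \<Rightarrow>\<^sub>0 'k)"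
  "linear_ext realize (trl XYZ) = (translator 1 2 3 :: _ \<Rightarrow>\<^sub>0 'k)"
  "linear_ext realize (trl XZY) = (translator 1 3 2 :: _ \<Rightarrow>\<^sub>0 'k)"
  "linear_ext realize (trl YXZ) = (translator 2 1 3 :: _ \<Rightarrow>\<^sub>0 'k)"
  "linear_ext realize (trl YZX) = (translator 2 3 1 :: _ \<Rightarrow>\<^sub>0 'k)"
  "linear_ext realize (trl ZXY) = (translator 3 1 2 :: _ \<Rightarrow>\<^sub>0 'k)"
  "linear_ext realize (trl ZYX) = (translator 3 2 1 :: _ \<Rightarrow>\<^sub>0 'k)"
  by (simp_all add: com_def trl_def commutator_def translator_def linear_ext_single corolla_def)

lemma generators_in_shuffle_operad:
  "com p \<in> shuffle_operad 3" "trl p \<in> shuffle_operad 3"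
  by (auto simp: com_def trl_def shuffle_operad_def shuffle_monomials_def sym_monomials_def
      corolla_def min_leaf_def)

lemma comtrans_basis_in_forget_ideal:
  fixes f :: "comtrans_gen tree \<Rightarrow>\<^sub>0 'k::field"
  assumes "f \<in> set comtrans_basis"
  shows "f \<in> forget_ideal comtrans_ideal 3"
proof -
  let ?I = "comtrans_ideal 3 :: (_ \<Rightarrow>\<^sub>0 'k) set"
  have I: "is_subspace ?I"
    using sym_ideal_comtrans_ideal[where 'k = 'k] by (simp add: sym_ideal_def)
  have S: "is_subspace (shuffle_operad 3 :: (comtrans_gen tree \<Rightarrow>\<^sub>0 'k) set)"
    unfolding shuffle_operad_def by (rule is_subspace_supported)
  have "f \<in> shuffle_operad 3"
    using assms S unfolding comtrans_basis_def
    by (auto intro!: is_subspace_add is_subspace_diff generators_in_shuffle_operad)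
  moreover have "linear_ext realize f \<in> ?I"
  proof -
    have zero: "0 \<in> ?I" using I by (simp add: is_subspace_def)
    have perms: "{1, 2, 3} = {1, 2, 3::nat}" "{1, 3, 2} = {1, 2, 3::nat}" "{2, 1, 3} = {1, 2, 3::nat}"
      "{2, 3, 1} = {1, 2, 3::nat}" by auto
    have d: "distinct [1, 2, 3::nat]" "distinct [1, 3, 2::nat]" "distinct [2, 1, 3::nat]"
      "distinct [2, 3, 1::nat]" by auto
    note R = comtrans_ideal_relations[where 'k = 'k]
    note R123 = R[OF perms(1) d(1)] and R132 = R[OF perms(2) d(2)] and R213 = R[OF perms(3) d(3)]
      and R231 = R[OF perms(4) d(4)]
    \<comment> \<open>The first four basis elements, in order, as combinations of the orbits; the last three are commutator relations.\<close>
    note intros = is_subspace_diff[OF I R123(1) R123(3)] is_subspace_add[OF I R132(2) R213(3)]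
      is_subspace_diff[OF I zero R213(3)]
      is_subspace_diff[OF I R123(2) is_subspace_diff[OF I R123(1) R123(3)]]
      R123(1) R132(1) R231(1)
    from assms consider 
      "f = trl XYZ + trl ZYX + com YXZ - com ZYX"
      | "f = trl XZY - trl ZXY + trl ZYX + com YXZ + com ZXY"
      | "f = trl YXZ + trl ZXY - com YXZ - com ZXY"
      | "f = trl YZX + trl ZXY - trl ZYX - com YXZ + com ZYX"
      | "f = com XYZ + com YXZ" | "f = com XZY + com ZXY" | "f = com YZX + com ZYX"
      by (auto simp: comtrans_basis_def)
    then show ?thesis
      by cases (hypsubst, unfold linear_ext_add linear_ext_diff linear_ext_realize_generators,
          insert intros, simp add: algebra_simps)+
  qed
  ultimately show ?thesis by (simp add: forget_ideal_def)
qed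

lemma corolla_inject [simp]: "corolla g = corolla h \<longleftrightarrow> g = h"
  by (simp add: corolla_def)

lemma corolla_in_image [simp]: "corolla g \<in> corolla ` A \<longleftrightarrow> g \<in> A"
  by (auto simp del: split_paired_Ex)

lemma corolla_less: "(g, h) \<in> generator_less \<Longrightarrow> (corolla g, corolla h) \<in> comtrans_less"
  by (simp add: comtrans_less_def path_deglex_def path_sequence_def corolla_def upt_rec Cons_lenlex_iff)

lemma leading_monomial_corollas:
  assumes "Poly_Mapping.lookup f (corolla g) \<noteq> 0"
    "Poly_Mapping.keys f \<subseteq> corolla ` insert g {h. rank g < rank h}"
  shows "leading_monomial comtrans_less f = corolla g"
  using assms trans_comtrans_less irrefl_comtrans_less
  by (intro leading_monomial_eqI) (auto simp: in_keys_iff[of "corolla g"] generator_less_iff intro!: corolla_less)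

lemma leading_monomials_comtrans_basis:
  "map (leading_monomial comtrans_less) (comtrans_basis :: (comtrans_gen tree \<Rightarrow>\<^sub>0 'k::field) list) =
     map corolla leading_generators"
  unfolding comtrans_basis_def leading_generators_def list.map
  by (intro arg_cong2[of _ _ _ _ Cons] leading_monomial_corollas refl)
    (auto simp: com_def trl_def lookup_add lookup_minus lookup_single when_def in_keys_iff
       split: if_splits)

lemma comtrans_basis_nonzero:
  "(0 :: comtrans_gen tree \<Rightarrow>\<^sub>0 'k::field) \<notin> set comtrans_basis"
proof
  assume "(0 :: comtrans_gen tree \<Rightarrow>\<^sub>0 'k) \<in> set comtrans_basis"
  then have "\<exists>f\<in>set comtrans_basis. \<forall>g. Poly_Mapping.lookup (f :: comtrans_gen tree \<Rightarrow>\<^sub>0 'k) (corolla g) = 0"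
    by (intro bexI[of _ 0]) auto
  then obtain f :: "comtrans_gen tree \<Rightarrow>\<^sub>0 'k" where "f \<in> set comtrans_basis"
    "\<forall>g\<in>set leading_generators. Poly_Mapping.lookup f (corolla g) = 0" by blast
  then show False
    by (auto simp: comtrans_basis_def leading_generators_def com_def trl_def lookup_add lookup_minus lookup_single)
qed

theorem mainTheorem1:
  shows "groebner_basis comtrans_less
           (forget_ideal (comtrans_ideal :: nat \<Rightarrow> (comtrans_op tree \<Rightarrow>\<^sub>0 'k::field_char_0) set))
           (set comtrans_basis) \<and>
         map (leading_monomial comtrans_less)
             (comtrans_basis :: (comtrans_gen tree \<Rightarrow>\<^sub>0 'k) list) =
         map corolla
           [(Translator, XYZ), (Translator, XZY), (Translator, YXZ), (Translator, YZX),
            (Commutator, XYZ), (Commutator, XZY), (Commutator, YZX)]"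
proof
  let ?B = "comtrans_basis :: (comtrans_gen tree \<Rightarrow>\<^sub>0 'k) list"
  let ?J = "forget_ideal (comtrans_ideal :: nat \<Rightarrow> (comtrans_op tree \<Rightarrow>\<^sub>0 'k) set)"
  have lm: "leading_monomial comtrans_less ` set ?B = corolla ` set leading_generators"
    using arg_cong[OF leading_monomials_comtrans_basis[where 'k = 'k], of set] by simp
  have "\<exists>g\<in>set ?B. g \<noteq> 0 \<and> divides (leading_monomial comtrans_less g) (leading_monomial comtrans_less f)"
    if f: "f \<in> ?J n" "f \<noteq> 0" for n f
  proof -
    obtain g where g: "g \<in> set leading_generators" "divides (corolla g) (leading_monomial comtrans_less f)"
      using leading_monomial_not_normal[OF f] by blast
    then obtain b where "b \<in> set ?B" "leading_monomial comtrans_less b = corolla g"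
      using lm by (metis (no_types, lifting) imageE imageI)
    then show ?thesis using g(2) comtrans_basis_nonzero by metis
  qed
  then show "groebner_basis comtrans_less ?J (set ?B)"
    unfolding groebner_basis_def
    using shuffle_ideal_forget_ideal[OF sym_ideal_comtrans_ideal] comtrans_basis_in_forget_ideal
    by blast
  show "map (leading_monomial comtrans_less) ?B = map corolla
           [(Translator, XYZ), (Translator, XZY), (Translator, YXZ), (Translator, YZX),
            (Commutator, XYZ), (Commutator, XZY), (Commutator, YZX)]"
    using leading_monomials_comtrans_basis unfolding leading_generators_def .
qed

end
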